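(* For any constant $0<\varepsilon<1/3$, any randomized algorithm that with high probability estimates the metric Steiner Tree cost to within a factor of $(2-\varepsilon)$ performs at least $\tilde\Omega(n+k^{6/5})$ queries in the worst case.
   Context: An instance of the metric Steiner Tree problem is a triple $(V,T,w)$ where $V$ is a set of $n$ points, $T\subseteq V$ is a set of $k$ terminals, and $w$ is a metric on $V$. A Steiner tree is a tree whose vertices are points of $V$ and which contains all points of $T$; its cost is the sum of $w(u,v)$ over its edges $(u,v)$. ${\mathsf{ST}}(V,T,w)$ denotes the minimum cost of a Steiner tree. An algorithm knows $V$ and $T$ but can access $w$ only through queries: a query specifies a pair $u,v\in V$ and returns $w(u,v)$. An algorithm estimates the Steiner Tree cost to within a factor $\alpha\ge 1$ if it outputs a number $X$ with ${\mathsf{ST}}(V,T,w)\le X\le \alpha\cdot{\mathsf{ST}}(V,T,w)$. $\tilde\Omega(\cdot)$ hides polylogarithmic factors.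
   Formalization: The bound is proved for all n and k with k at least a constant and k ≤ γn, for any constant γ < 1; for all k ≤ n it fails, since one query settles k = 2 and for k = n the cost is the MST cost, estimable with Õ(n) queries. *)

theory Defs
  imports "HOL-Probability.Probability"
begin

section \<open>Metric Steiner Tree\<close>

text \<open>
  An undirected simple graph is a vertex set together with a set of two-element vertex sets.
  (The \<open>tree\<close> of \<open>Graph_Theory\<close> is about digraphs and excludes directed cycles only: it accepts
  the transitive triangle and rejects a symmetric digraph that has an edge.)
\<close>

definition is_graph :: "'v set \<Rightarrow> 'v set set \<Rightarrow> bool" where
  "is_graph S E \<longleftrightarrow> (\<forall>e\<in>E. \<exists>u\<in>S. \<exists>v\<in>S. u \<noteq> v \<and> e = {u, v})"

definition graph_connected :: "'v set \<Rightarrow> 'v set set \<Rightarrow> bool" where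
  "graph_connected S E \<longleftrightarrow> (\<forall>u\<in>S. \<forall>v\<in>S. (u, v) \<in> {(x, y). {x, y} \<in> E}\<^sup>*)"

definition is_cycle :: "'v set set \<Rightarrow> 'v list \<Rightarrow> bool" where
  "is_cycle E p \<longleftrightarrow> 3 \<le> length p \<and> distinct p \<and>
     (\<forall>i<length p. {p ! i, p ! (Suc i mod length p)} \<in> E)"

definition is_tree :: "'v set \<Rightarrow> 'v set set \<Rightarrow> bool" where
  "is_tree S E \<longleftrightarrow> S \<noteq> {} \<and> is_graph S E \<and> graph_connected S E \<and> (\<nexists>p. is_cycle E p)"

text \<open>
  Points are natural numbers, so that there are instances of every finite size. The condition
  \<open>u < v\<close> in the cost selects one orientation of each edge; it is irrelevant which one, since a
  metric is symmetric.
\<close>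

type_synonym weight = "nat \<Rightarrow> nat \<Rightarrow> real"

definition steiner_instance :: "nat set \<Rightarrow> nat set \<Rightarrow> weight \<Rightarrow> bool" where
  "steiner_instance V T w \<longleftrightarrow> finite V \<and> V \<noteq> {} \<and> T \<subseteq> V \<and> Metric_space V w"

definition steiner_tree :: "nat set \<Rightarrow> nat set \<Rightarrow> nat set \<Rightarrow> nat set set \<Rightarrow> bool" where
  "steiner_tree V T S E \<longleftrightarrow> is_tree S E \<and> T \<subseteq> S \<and> S \<subseteq> V"

definition tree_cost :: "weight \<Rightarrow> nat set set \<Rightarrow> real" where
  "tree_cost w E = (\<Sum>(u, v) \<in> {(u, v). u < v \<and> {u, v} \<in> E}. w u v)"

text \<open>On an instance the minimum is over a finite nonempty set, as \<open>V\<close> is finite and nonempty.\<close>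

definition ST :: "nat set \<Rightarrow> nat set \<Rightarrow> weight \<Rightarrow> real" where
  "ST V T w = Min {tree_cost w E | S E. steiner_tree V T S E}"

section \<open>Randomized query algorithms\<close>

text \<open>
  Once \<open>V\<close>, \<open>T\<close> and the outcome of its coins are fixed, an algorithm is an adaptive decision tree:
  it either outputs a number, or queries a pair of points and continues according to the answer.
  Computation between queries is free.
\<close>

datatype query_tree = Output real | Query nat nat "real \<Rightarrow> query_tree"

primrec result :: "query_tree \<Rightarrow> weight \<Rightarrow> real" where
  "result (Output x) w = x"
| "result (Query u v next_step) w = result (next_step (w u v)) w"

primrec num_queries :: "query_tree \<Rightarrow> weight \<Rightarrow> nat" where
  "num_queries (Output x) w = 0"
| "num_queries (Query u v next_step) w = Suc (num_queries (next_step (w u v)) w)"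

primrec queries_within :: "nat set \<Rightarrow> query_tree \<Rightarrow> bool" where
  "queries_within V (Output x) \<longleftrightarrow> True"
| "queries_within V (Query u v next_step) \<longleftrightarrow>
     u \<in> V \<and> v \<in> V \<and> (\<forall>a. queries_within V (next_step a))"

text \<open>
  The randomness is an infinite sequence of coins under an arbitrary probability measure, drawn
  independently of the metric. The metric is not an argument of the algorithm; it is accessed
  only through queries.
\<close>

type_synonym coins = "nat \<Rightarrow> bool"
type_synonym query_algorithm = "nat set \<Rightarrow> nat set \<Rightarrow> coins \<Rightarrow> query_tree"

definition randomized_algorithm :: "coins measure \<Rightarrow> query_algorithm \<Rightarrow> bool" where
  "randomized_algorithm M A \<longleftrightarrow>
     prob_space M \<and> (\<forall>V T. \<forall>\<omega>\<in>space M. queries_within V (A V T \<omega>))"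

text \<open>
  \<open>\<delta>\<close> is the permitted failure probability as a function of the number of points. A set that is
  not an event has \<open>measure\<close> zero, so the inequality also forces success to be an event as soon as
  \<open>\<delta> (card V) < 1\<close>.
\<close>

definition estimates_ST ::
    "coins measure \<Rightarrow> query_algorithm \<Rightarrow> real \<Rightarrow> (nat \<Rightarrow> real) \<Rightarrow> bool" where
  "estimates_ST M A \<alpha> \<delta> \<longleftrightarrow>
     (\<forall>V T w. steiner_instance V T w \<longrightarrow>
        measure M {\<omega> \<in> space M. ST V T w \<le> result (A V T \<omega>) w
                              \<and> result (A V T \<omega>) w \<le> \<alpha> * ST V T w} \<ge> 1 - \<delta> (card V))"

text \<open>
  The worst case is taken over the instances with \<open>n\<close> points and \<open>k\<close> terminals and over the coins,
  disregarding outcomes of probability zero: on some instance it is not almost sure that fewer than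
  \<open>B\<close> queries are made.
\<close>

definition worst_case_queries_at_least ::
    "coins measure \<Rightarrow> query_algorithm \<Rightarrow> nat \<Rightarrow> nat \<Rightarrow> real \<Rightarrow> bool" where
  "worst_case_queries_at_least M A n k B \<longleftrightarrow>
     (\<exists>V T w. steiner_instance V T w \<and> card V = n \<and> card T = k \<and>
        \<not> (AE \<omega> in M. real (num_queries (A V T \<omega>) w) < B))"

end

theory Submission
  imports Defs
begin

text \<open>
  Points carry hidden labels. Of the \<open>k\<close> terminals about \<open>h \<approx> k\<^sup>2\<^sup>/\<^sup>3\<close> carry labels
  below \<open>h\<close>, the others are spread over \<open>f \<approx> \<epsilon> h / 64\<close> further labels; terminals with the same
  label are almost at distance 0, a non-terminal is at distance 1 from the terminals whose label it
  carries, and all other distances are 2. In a NO instance every non-terminal carries one label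
  below \<open>h\<close>, so a Steiner tree pays 2 for all but one of the labels in use. In a YES instance a few
  non-terminals are hubs with many labels, through which almost every label is connected at cost 1.

  Given the labels of the terminals, the non-terminals are independent. The YES distribution is tuned
  so that a single label has the same probability at a non-terminal as in the NO distribution.
  Hence a run distinguishes the two only through non-terminals that are known to be close to a
  terminal and that are compared with another label below \<open>h\<close>. The likelihood of a NO run decreases
  by at most a factor of two in the YES distribution as long as there are few such pairs.

  This number is at most the number of queries, which settles the case \<open>n \<ge> k\<^sup>6\<^sup>/\<^sup>5\<close>. Otherwise, a
  terminal with a label below \<open>h\<close> is rare and remains indistinguishable from the other
  terminals until it has met about \<open>f\<close> other points or its label has been hit, and so only
  about \<open>q / k\<close> of them become exposed by \<open>q\<close> queries; similarly, only about \<open>q / h\<close> non-terminals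
  become exposed. The product of these bounds and the number of queries on unexposed terminals
  with labels below \<open>h\<close> are both \<open>o(k)\<close> for \<open>q = O(k\<^sup>6\<^sup>/\<^sup>5)\<close>.
\<close>

section \<open>Trees and their cost\<close>

lemma exit_edge:
  assumes "(r, v) \<in> R\<^sup>*" "P r" "\<not> P v"
  obtains x y where "(x, y) \<in> R" "P x" "\<not> P y"
  using assms by (induction rule: rtrancl_induct) auto

lemma graph_edges_subset:
  assumes "is_graph S E"
  shows "E \<subseteq> Pow S"
proof
  fix e assume "e \<in> E"
  with assms obtain u v where "u \<in> S" "v \<in> S" "e = {u, v}" unfolding is_graph_def by meson
  then show "e \<in> Pow S" by simp
qed

text \<open>Contracting every colour class leaves a connected graph on the colours, which has at
  least as many edges as vertices minus one. \<open>Suc\<close> on the right replaces a truncated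
  subtraction on the left.\<close>

lemma card_classes_le_crossing_edges:
  assumes fin: "finite S" and ne: "S \<noteq> {}" and g: "is_graph S E" and con: "graph_connected S E"
  shows "card (col ` S) \<le> Suc (card {e \<in> E. \<exists>x\<in>e. \<exists>y\<in>e. col x \<noteq> col y})"
proof -
  define C where "C = {e \<in> E. \<exists>x\<in>e. \<exists>y\<in>e. col x \<noteq> col y}"
  have "finite E" using graph_edges_subset[OF g] fin by (meson finite_Pow_iff finite_subset)
  then have finC: "finite C" unfolding C_def by simp
  obtain r where r: "r \<in> S" using ne by blast
  \<comment> \<open>A set \<open>F\<close> of reached colours grows from \<open>col r\<close> one
    colour at a time. The edge by which a path leaves \<open>F\<close> is new, as one of its ends
    has a colour outside \<open>F\<close>.\<close>
  have *: "\<exists>F \<subseteq> col ` S. card F = Suc j \<and> col r \<in> F \<and> j \<le> card {e \<in> C. col ` e \<subseteq> F}"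
    if "Suc j \<le> card (col ` S)" for j
    using that
  proof (induction j)
    case 0
    show ?case by (rule exI[of _ "{col r}"]) (use r in auto)
  next
    case (Suc j)
    then obtain F where F: "F \<subseteq> col ` S" "card F = Suc j" "col r \<in> F"
      "j \<le> card {e \<in> C. col ` e \<subseteq> F}" by (metis Suc_leD)
    have "F \<noteq> col ` S" using F Suc.prems by auto
    then obtain v where v: "v \<in> S" "col v \<notin> F" using F by blast
    have "(r, v) \<in> {(x, y). {x, y} \<in> E}\<^sup>*" using con r v unfolding graph_connected_def by blast
    then obtain x y where "(x, y) \<in> {(x, y). {x, y} \<in> E}" and cxy: "col x \<in> F" "col y \<notin> F"
      by (rule exit_edge[where P = "\<lambda>x. col x \<in> F"]) (use F(3) v(2) in auto)
    then have xy: "{x, y} \<in> E" "col x \<in> F" "col y \<notin> F" by auto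
    have yS: "y \<in> S" using graph_edges_subset[OF g] xy by blast
    let ?F = "insert (col y) F"
    have "{x, y} \<in> C" unfolding C_def using xy by auto
    then have "insert {x, y} {e \<in> C. col ` e \<subseteq> F} \<subseteq> {e \<in> C. col ` e \<subseteq> ?F}"
      using xy by auto
    then have "card (insert {x, y} {e \<in> C. col ` e \<subseteq> F}) \<le> card {e \<in> C. col ` e \<subseteq> ?F}"
      using finC by (intro card_mono) auto
    moreover have "card (insert {x, y} {e \<in> C. col ` e \<subseteq> F}) = Suc (card {e \<in> C. col ` e \<subseteq> F})"
      using finC xy by (intro card_insert_disjoint) auto
    moreover have "card ?F = Suc (Suc j)"
      using F xy fin by (metis card_insert_disjoint card.infinite nat.simps(3))
    ultimately show ?case using F yS by (intro exI[of _ ?F]) auto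
  qed
  show ?thesis
  proof (cases "card (col ` S)")
    case (Suc j)
    with * obtain F where "j \<le> card {e \<in> C. col ` e \<subseteq> F}" by (metis order_refl)
    also have "\<dots> \<le> card C" using finC by (intro card_mono) auto
    finally show ?thesis using Suc unfolding C_def by simp
  qed simp
qed

lemma finite_edge_pairs:
  fixes S :: "nat set"
  assumes "finite S" "is_graph S E"
  shows "finite {(u, v). u < v \<and> {u, v} \<in> E}"
  by (rule finite_subset[of _ "S \<times> S"]) (use assms graph_edges_subset[of S E] in auto)

lemma tree_cost_ge_classes:
  assumes fin: "finite S" and tr: "is_tree S E"
    and nn: "\<And>x y. 0 \<le> w x y"
    and far: "\<And>x y. x \<in> S \<Longrightarrow> y \<in> S \<Longrightarrow> col x \<noteq> col y \<Longrightarrow> 2 \<le> w x y"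
  shows "2 * (real (card (col ` S)) - 1) \<le> tree_cost w E"
proof -
  have g: "is_graph S E" and con: "graph_connected S E" and ne: "S \<noteq> {}"
    using tr unfolding is_tree_def by auto
  let ?P = "{(u, v). u < v \<and> {u, v} \<in> E}"
  let ?Q = "{(u, v). u < v \<and> {u, v} \<in> E \<and> col u \<noteq> col v}"
  let ?C = "{e \<in> E. \<exists>x\<in>e. \<exists>y\<in>e. col x \<noteq> col y}"
  have finP: "finite ?P" by (rule finite_edge_pairs[OF fin g])
  have QP: "?Q \<subseteq> ?P" by auto
  have finQ: "finite ?Q" using finP QP by (rule rev_finite_subset)
  \<comment> \<open>The cost sums over pairs \<open>u < v\<close> instead of edges, so crossing
    edges are matched with such pairs.\<close>
  have "?C \<subseteq> (\<lambda>(u, v). {u, v}) ` ?Q"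
  proof
    fix e assume e: "e \<in> ?C"
    then obtain u v where uv: "u \<noteq> v" "e = {u, v}" using g unfolding is_graph_def by blast
    with e have c: "col u \<noteq> col v" by auto
    show "e \<in> (\<lambda>(u, v). {u, v}) ` ?Q"
    proof (cases "u < v")
      case True then show ?thesis using e uv c by (intro image_eqI[of _ _ "(u, v)"]) auto
    next
      case False then show ?thesis using e uv c
        by (intro image_eqI[of _ _ "(v, u)"]) (auto simp: insert_commute)
    qed
  qed
  then have "card ?C \<le> card ?Q"
    using finQ by (meson card_image_le card_mono finite_imageI le_trans)
  then have "real (card (col ` S)) - 1 \<le> real (card ?Q)"
    using card_classes_le_crossing_edges[OF fin ne g con, of col] by linarith
  then have "2 * (real (card (col ` S)) - 1) \<le> (\<Sum>p\<in>?Q. 2)" by simp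
  also have "\<dots> \<le> (\<Sum>(u, v)\<in>?Q. w u v)"
    using far graph_edges_subset[OF g] by (intro sum_mono) auto
  also have "\<dots> \<le> tree_cost w E"
    unfolding tree_cost_def using finP QP nn by (intro sum_mono2) auto
  finally show ?thesis .
qed

section \<open>Trees given by a root and a parent function\<close>

definition parent_edges :: "nat set \<Rightarrow> nat \<Rightarrow> (nat \<Rightarrow> nat) \<Rightarrow> nat set set" where
  "parent_edges S r par = (\<lambda>v. {v, par v}) ` (S - {r})"

text \<open>On a cycle, a vertex \<open>v\<close> of maximal level can only be joined to
  \<open>par v\<close>, since every edge has its higher level at the child. The two neighbours of
  \<open>v\<close> on the cycle would then coincide.\<close>

lemma parent_edges_no_cycle:
  assumes lev: "\<And>v. v \<in> S \<Longrightarrow> v \<noteq> r \<Longrightarrow> lev (par v) < (lev v :: nat)"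
  shows "\<not> is_cycle (parent_edges S r par) p"
proof
  assume c: "is_cycle (parent_edges S r par) p"
  let ?n = "length p"
  have n: "3 \<le> ?n" and d: "distinct p"
    and E: "\<And>i. i < ?n \<Longrightarrow> {p ! i, p ! (Suc i mod ?n)} \<in> parent_edges S r par"
    using c unfolding is_cycle_def by auto
  have "finite (lev ` set p)" "lev ` set p \<noteq> {}" using n by auto
  then have "Max (lev ` set p) \<in> lev ` set p" by (rule Max_in)
  then obtain v where v: "v \<in> set p" "lev v = Max (lev ` set p)" by auto
  then have mx: "lev x \<le> lev v" if "x \<in> set p" for x using that by simp
  obtain i where i: "i < ?n" "p ! i = v" using v by (auto simp: in_set_conv_nth)
  have up: "a = par v" if "{v, a} \<in> parent_edges S r par" "a \<in> set p" for a
  proof -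
    from that obtain x where x: "x \<in> S" "x \<noteq> r" "{v, a} = {x, par x}"
      unfolding parent_edges_def by blast
    then have "lev (par x) < lev x" using lev by blast
    then show ?thesis using x mx[OF that(2)] by (auto simp: doubleton_eq_iff)
  qed
  \<comment> \<open>\<open>?j\<close> and \<open>?k\<close> are the positions before and after
    \<open>v\<close>. Adding \<open>?n\<close> before subtracting 1 lets position 0 wrap
    around.\<close>
  let ?j = "(i + ?n - 1) mod ?n"
  let ?k = "Suc i mod ?n"
  have pos: "0 < ?n" using n by linarith
  then have j1: "?j < ?n" and k: "?k < ?n" by (rule mod_less_divisor)+
  have "Suc ?j mod ?n = Suc (i + ?n - 1) mod ?n" by (rule mod_Suc_eq)
  also have "Suc (i + ?n - 1) = i + ?n" using pos by linarith
  also have "(i + ?n) mod ?n = i" using i by simp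
  finally have j: "?j < ?n" "Suc ?j mod ?n = i" using j1 by auto
  \<comment> \<open>The two positions differ because a cycle has length at least 3, so that 2 is not
    a multiple of \<open>?n\<close>.\<close>
  have jk: "?j \<noteq> ?k"
  proof
    assume "?j = ?k"
    with j have "Suc ?k mod ?n = i" by simp
    then have eq: "(i + 2) mod ?n = i" by (simp add: mod_Suc_eq)
    show False
    proof (cases "i + 2 < ?n")
      case False
      with n i have "(i + 2) mod ?n = i + 2 - ?n" by (subst le_mod_geq) auto
      with eq False n show False by linarith
    qed (use eq in simp)
  qed
  have "p ! ?k = par v" using E[OF i(1)] i(2) k by (intro up) auto
  moreover have "p ! ?j = par v"
    using E[OF j(1)] j i(2) by (intro up) (auto simp: insert_commute)
  ultimately show False using d jk j k by (metis nth_eq_iff_index_eq)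
qed

text \<open>Following parents lowers the level and so must end at \<open>r\<close>, the only vertex
  without a parent edge of its own.\<close>

lemma is_tree_parent_edges:
  assumes r: "r \<in> S" and par: "\<And>v. v \<in> S \<Longrightarrow> v \<noteq> r \<Longrightarrow> par v \<in> S"
    and lev: "\<And>v. v \<in> S \<Longrightarrow> v \<noteq> r \<Longrightarrow> lev (par v) < (lev v :: nat)"
  shows "is_tree S (parent_edges S r par)"
proof -
  let ?E = "parent_edges S r par"
  let ?R = "{(x, y). {x, y} \<in> ?E}"
  have g: "is_graph S ?E"
    unfolding is_graph_def
  proof
    fix e assume "e \<in> ?E"
    then obtain v where v: "v \<in> S" "v \<noteq> r" "e = {v, par v}"
      unfolding parent_edges_def by blast
    then have "par v \<noteq> v" using lev[of v] by auto
    with v par[of v] show "\<exists>u\<in>S. \<exists>v\<in>S. u \<noteq> v \<and> e = {u, v}" by metis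
  qed
  have sym: "sym ?R" by (auto simp: sym_def insert_commute)
  have toroot: "(v, r) \<in> ?R\<^sup>*" if "v \<in> S" for v
    using that
  proof (induction "lev v" arbitrary: v rule: less_induct)
    case less
    show ?case
    proof (cases "v = r")
      case False
      then have "(v, par v) \<in> ?R" using less.prems unfolding parent_edges_def by auto
      moreover have "(par v, r) \<in> ?R\<^sup>*" using less False par lev by blast
      ultimately show ?thesis by (rule converse_rtrancl_into_rtrancl)
    qed simp
  qed
  have "(u, v) \<in> ?R\<^sup>*" if "u \<in> S" "v \<in> S" for u v
  proof -
    have "(r, v) \<in> ?R\<^sup>*" using toroot[OF that(2)] sym_rtrancl[OF sym] by (meson symD)
    with toroot[OF that(1)] show ?thesis by (rule rtrancl_trans)
  qed
  then have "graph_connected S ?E" unfolding graph_connected_def by blast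
  with g parent_edges_no_cycle[of S r lev par, OF lev] show ?thesis
    unfolding is_tree_def using r by blast
qed

text \<open>Only an inequality: loops and vertices that give the same edge are all counted on the
  right, but at most once on the left.\<close>

lemma tree_cost_parent_edges_le:
  assumes fin: "finite S" and nn: "\<And>x y. 0 \<le> w x y" and sym: "\<And>x y. w x y = w y x"
  shows "tree_cost w (parent_edges S r par) \<le> (\<Sum>v\<in>S - {r}. w v (par v))"
proof -
  let ?g = "\<lambda>v. (min v (par v), max v (par v))"
  let ?P = "{(u, v). u < v \<and> {u, v} \<in> parent_edges S r par}"
  have sub: "?P \<subseteq> ?g ` (S - {r})"
  proof
    fix q assume "q \<in> ?P"
    then obtain u v x where q: "q = (u, v)" "u < v" "x \<in> S - {r}" "{u, v} = {x, par x}"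
      unfolding parent_edges_def by blast
    then have "q = ?g x" by (auto simp: doubleton_eq_iff)
    then show "q \<in> ?g ` (S - {r})" using q by blast
  qed
  have "tree_cost w (parent_edges S r par) \<le> (\<Sum>(u, v)\<in>?g ` (S - {r}). w u v)"
    unfolding tree_cost_def using fin sub nn by (intro sum_mono2) auto
  also have "\<dots> \<le> (\<Sum>v\<in>S - {r}. (\<lambda>(u, v). w u v) (?g v))"
    using fin nn by (intro sum_image_le[of _ "\<lambda>(u, v). w u v" ?g, unfolded o_def]) auto
  also have "\<dots> = (\<Sum>v\<in>S - {r}. w v (par v))"
    by (intro sum.cong refl) (auto simp: min_def max_def sym)
  finally show ?thesis .
qed

section \<open>The minimum over all Steiner trees\<close>

lemma finite_steiner_costs:
  assumes "finite V"
  shows "finite {tree_cost w E | S E. steiner_tree V T S E}"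
proof -
  have "{tree_cost w E | S E. steiner_tree V T S E} \<subseteq> tree_cost w ` Pow (Pow V)"
  proof
    fix x assume "x \<in> {tree_cost w E | S E. steiner_tree V T S E}"
    then obtain S E where x: "x = tree_cost w E" and st: "steiner_tree V T S E" by blast
    from st have "is_graph S E" "S \<subseteq> V" unfolding steiner_tree_def is_tree_def by auto
    with graph_edges_subset[of S E] have "E \<in> Pow (Pow V)" by auto
    with x show "x \<in> tree_cost w ` Pow (Pow V)" by blast
  qed
  then show ?thesis using assms by (meson finite_Pow_iff finite_imageI finite_subset)
qed

lemma ST_le:
  assumes "finite V" "steiner_tree V T S E"
  shows "ST V T w \<le> tree_cost w E"
  unfolding ST_def using finite_steiner_costs[OF assms(1)] assms(2) by (intro Min_le) auto

lemma ST_ge_classes: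
  assumes inst: "steiner_instance V T w"
    and far: "\<And>x y. x \<in> V \<Longrightarrow> y \<in> V \<Longrightarrow> col x \<noteq> col y \<Longrightarrow> 2 \<le> w x y"
  shows "2 * (real (card (col ` T)) - 1) \<le> ST V T w"
proof -
  have fin: "finite V" and ne: "V \<noteq> {}" and TV: "T \<subseteq> V" and M: "Metric_space V w"
    using inst unfolding steiner_instance_def by auto
  obtain r where r: "r \<in> V" using ne by blast
  \<comment> \<open>The star on \<open>V\<close> shows that the minimum is over a nonempty
    set.\<close>
  have "is_tree V (parent_edges V r (\<lambda>_. r))"
    by (rule is_tree_parent_edges[where lev = "\<lambda>v. if v = r then 0 else 1"]) (use r in auto)
  then have "steiner_tree V T V (parent_edges V r (\<lambda>_. r))"
    using TV unfolding steiner_tree_def by simp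
  then have ne': "{tree_cost w E | S E. steiner_tree V T S E} \<noteq> {}" by blast
  have "2 * (real (card (col ` T)) - 1) \<le> tree_cost w E" if st: "steiner_tree V T S E" for S E
  proof -
    have S: "is_tree S E" "T \<subseteq> S" "S \<subseteq> V" using st unfolding steiner_tree_def by auto
    have finS: "finite S" using S fin finite_subset by blast
    have c: "card (col ` T) \<le> card (col ` S)" using finS S by (intro card_mono) auto
    from c have "2 * (real (card (col ` T)) - 1) \<le> 2 * (real (card (col ` S)) - 1)" by simp
    also have "\<dots> \<le> tree_cost w E"
      by (rule tree_cost_ge_classes[OF finS S(1) Metric_space.nonneg[OF M] far]) (use S(3) in auto)
    finally show ?thesis .
  qed
  then show ?thesis unfolding ST_def
    using finite_steiner_costs[OF fin] ne' by (intro Min.boundedI) auto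
qed

section \<open>Runs of a query algorithm\<close>

primrec path :: "query_tree \<Rightarrow> weight \<Rightarrow> (nat \<times> nat) list" where
  "path (Output x) w = []"
| "path (Query u v next_step) w = (u, v) # path (next_step (w u v)) w"

lemma length_path: "length (path tr w) = num_queries tr w"
  by (induction tr) auto

lemma path_within: "queries_within V tr \<Longrightarrow> set (path tr w) \<subseteq> V \<times> V"
  by (induction tr) auto

lemma path_result_agree:
  "(\<And>x y. (x, y) \<in> set (path tr w) \<Longrightarrow> w' x y = w x y) \<Longrightarrow>
   path tr w' = path tr w \<and> result tr w' = result tr w"
  by (induction tr) auto

text \<open>The exclusive or leaves out the query of \<open>v\<close> with itself, whose answer is 0
  whatever the labels are; \<open>partner\<close> is then always another point.\<close>

definition meets :: "nat \<Rightarrow> nat \<times> nat \<Rightarrow> bool" where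
  "meets v e \<longleftrightarrow> (fst e = v) \<noteq> (snd e = v)"

definition partner :: "nat \<Rightarrow> nat \<times> nat \<Rightarrow> nat" where
  "partner v e = (if fst e = v then snd e else fst e)"

definition degree_in :: "nat \<Rightarrow> (nat \<times> nat) list \<Rightarrow> nat" where
  "degree_in v p = length (filter (meets v) p)"

lemma partner_neq: "meets v e \<Longrightarrow> partner v e \<noteq> v"
  unfolding meets_def partner_def by auto

text \<open>Handshake bound: a query meets at most two points.\<close>

lemma sum_degree_in_le:
  assumes "finite V"
  shows "(\<Sum>v\<in>V. degree_in v p) \<le> 2 * length p"
proof (induction p)
  case (Cons e p)
  have "degree_in v (e # p) = (if meets v e then 1 else 0) + degree_in v p" for v
    by (simp add: degree_in_def)
  then have "(\<Sum>v\<in>V. degree_in v (e # p)) = card {v \<in> V. meets v e} + (\<Sum>v\<in>V. degree_in v p)"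
    using assms by (simp add: sum.distrib sum.If_cases Int_def)
  moreover have "card {v \<in> V. meets v e} \<le> card {fst e, snd e}"
    by (intro card_mono) (auto simp: meets_def)
  moreover have "card {fst e, snd e} \<le> 2" by (simp add: card_insert_if)
  ultimately show ?case using Cons.IH by simp
qed (simp add: degree_in_def)

text \<open>The two runs proceed in lockstep through the first \<open>m\<close> queries at
  \<open>v\<close>, since all answers agree; the next query at \<open>v\<close> may be answered
  differently. In the induction \<open>m\<close> drops by one at each query that meets
  \<open>v\<close>.\<close>

lemma path_truncated:
  assumes off: "\<And>x y. \<not> meets v (x, y) \<Longrightarrow> w x y = w' x y"
    and agree: "\<And>x y. (x, y) \<in> set (take m (filter (meets v) (path tr w'))) \<Longrightarrow> w x y = w' x y"
  shows "min m (degree_in v (path tr w')) \<le> degree_in v (path tr w) \<and>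
         (degree_in v (path tr w') \<le> m \<longrightarrow> path tr w = path tr w')"
  using agree
proof (induction tr arbitrary: m)
  case (Query a b nx)
  show ?case
  proof (cases "meets v (a, b)")
    case False
    with off have "w a b = w' a b" by blast
    moreover have "min m (degree_in v (path (nx (w' a b)) w')) \<le> degree_in v (path (nx (w' a b)) w) \<and>
         (degree_in v (path (nx (w' a b)) w') \<le> m \<longrightarrow> path (nx (w' a b)) w = path (nx (w' a b)) w')"
      by (rule Query.IH) (use Query.prems False in auto)
    ultimately show ?thesis using False by (simp add: degree_in_def)
  next
    case True
    show ?thesis
    proof (cases m)
      case 0
      then show ?thesis using True by (simp add: degree_in_def)
    next
      case (Suc l)
      have "w a b = w' a b" using Query.prems True Suc by auto
      moreover have "min l (degree_in v (path (nx (w' a b)) w')) \<le> degree_in v (path (nx (w' a b)) w) \<and>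
         (degree_in v (path (nx (w' a b)) w') \<le> l \<longrightarrow> path (nx (w' a b)) w = path (nx (w' a b)) w')"
        by (rule Query.IH) (use Query.prems True Suc in auto)
      ultimately show ?thesis using True Suc by (simp add: degree_in_def)
    qed
  qed
qed (simp add: degree_in_def)

section \<open>Metrics from labels\<close>

text \<open>
  Points below \<open>k\<close> are terminals. A point \<open>x\<close> carries a set \<open>c x\<close> of labels; two points are close
  if they share a label, except that non-terminals are never close to each other.
\<close>

definition wt :: "nat \<Rightarrow> (nat \<Rightarrow> nat set) \<Rightarrow> weight" where
  "wt k c x y = (if x = y then 0 else if c x \<inter> c y = {} \<or> (k \<le> x \<and> k \<le> y) then 2
                 else if x < k \<and> y < k then 1 / real k else 1)"

lemma wt_nonneg: "0 \<le> wt k c x y"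
  unfolding wt_def by simp

lemma wt_commute: "wt k c x y = wt k c y x"
  unfolding wt_def by (auto simp: Int_commute)

lemma wt_le_2: "wt k c x y \<le> 2"
  unfolding wt_def by (cases "k = 0") (auto simp: field_simps)

lemma steiner_instance_wt:
  assumes k: "0 < k" "k \<le> n" and single: "\<And>t. t < k \<Longrightarrow> \<exists>i. c t = {i}"
  shows "steiner_instance {..<n} {..<k} (wt k c)"
proof -
  have k1: "1 / real k \<le> 1" "0 < 1 / real k" using k by (auto simp: field_simps)
  have tri: "wt k c x z \<le> wt k c x y + wt k c y z" for x y z
  proof -
    \<comment> \<open>All distances are at most 2, and only equal points or terminals with the same
      label are closer than 1. Such terminals have the same distance to any third point; in the last
      case both distances on the right are at least 1.\<close>
    consider "x = y" | "y = z" | "x \<noteq> y" "y \<noteq> z" "x < k" "y < k" "c x = c y"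
      | "x \<noteq> y" "y \<noteq> z" "z < k" "y < k" "c z = c y"
      | "x \<noteq> y" "y \<noteq> z" "\<not> (x < k \<and> y < k \<and> c x = c y)" "\<not> (z < k \<and> y < k \<and> c z = c y)"
      by blast
    then show ?thesis
    proof cases
      case 3
      then show ?thesis using k1 by (auto simp: wt_def)
    next
      case 4
      then show ?thesis using k1 by (auto simp: wt_def)
    next
      case 5
      have *: "1 \<le> wt k c a b" if "a \<noteq> b" "\<not> (a < k \<and> b < k \<and> c a = c b)" for a b
      proof -
        have "c a \<inter> c b = {}" if ab: "a < k" "b < k"
          using single[OF ab(1)] single[OF ab(2)] \<open>\<not> (a < k \<and> b < k \<and> c a = c b)\<close> ab by auto
        then show ?thesis using that unfolding wt_def by auto
      qed
      have "1 \<le> wt k c x y" "1 \<le> wt k c y z" using 5 by (auto intro!: *)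
      then show ?thesis using wt_le_2[of k c x z] by linarith
    qed (auto simp: wt_def)
  qed
  have "wt k c x y = 0 \<longleftrightarrow> x = y" for x y
    using k by (auto simp: wt_def)
  then have "Metric_space {..<n} (wt k c)"
    by (intro Metric_space.intro wt_nonneg wt_commute tri)
  moreover have "{..<n} \<noteq> {}" using k by (simp add: lessThan_empty_iff)
  ultimately show ?thesis using k unfolding steiner_instance_def by auto
qed

section \<open>Resampling the label of one point\<close>

lemma expectation_mono_supp:
  fixes F G :: "'a \<Rightarrow> real"
  assumes "finite (set_pmf p)" "\<And>x. x \<in> set_pmf p \<Longrightarrow> F x \<le> G x"
  shows "measure_pmf.expectation p F \<le> measure_pmf.expectation p G"
  using assms by (intro integral_mono_AE integrable_measure_pmf_finite) (auto simp: AE_measure_pmf_iff)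

lemma expectation_of_bool:
  "measure_pmf.expectation p (\<lambda>x. of_bool (Q x)) = measure_pmf.prob p {x. Q x}"
proof -
  have "(\<lambda>x. of_bool (Q x)) = (indicator {x. Q x} :: 'a \<Rightarrow> real)"
    by (auto simp: indicator_def)
  then show ?thesis by simp
qed

text \<open>Markov's inequality, for an event \<open>Q\<close> that implies
  \<open>a \<le> F x\<close> on the support.\<close>

lemma prob_le_expectation:
  assumes fin: "finite (set_pmf p)" and nn: "\<And>x. x \<in> set_pmf p \<Longrightarrow> 0 \<le> F x" and a: "0 < a"
    and Q: "\<And>x. x \<in> set_pmf p \<Longrightarrow> Q x \<Longrightarrow> a \<le> F x"
  shows "measure_pmf.prob p {x. Q x} \<le> measure_pmf.expectation p F / (a::real)"
proof -
  have "a * measure_pmf.prob p {x. Q x} = measure_pmf.expectation p (\<lambda>x. a * of_bool (Q x))"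
    by (simp add: expectation_of_bool)
  also have "\<dots> \<le> measure_pmf.expectation p F"
    using nn Q a by (intro expectation_mono_supp[OF fin]) (auto split: if_splits)
  finally show ?thesis using a by (simp add: field_simps)
qed

lemma expectation_pair_pmf:
  fixes H :: "'a \<Rightarrow> 'b \<Rightarrow> real"
  assumes "finite (set_pmf p)" "finite (set_pmf q)"
  shows "measure_pmf.expectation (pair_pmf p q) (\<lambda>(y, g). H y g) =
         measure_pmf.expectation q (\<lambda>g. measure_pmf.expectation p (\<lambda>y. H y g))"
proof -
  have "measure_pmf.expectation (pair_pmf p q) (\<lambda>(y, g). H y g) =
        (\<Sum>z\<in>set_pmf p \<times> set_pmf q. (case z of (y, g) \<Rightarrow> H y g) * pmf (pair_pmf p q) z)"
    using assms by (intro integral_measure_pmf_real) auto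
  also have "\<dots> = (\<Sum>y\<in>set_pmf p. \<Sum>g\<in>set_pmf q. H y g * (pmf p y * pmf q g))"
    unfolding sum.cartesian_product by (intro sum.cong refl) (auto simp: pmf_pair)
  also have "\<dots> = (\<Sum>g\<in>set_pmf q. (\<Sum>y\<in>set_pmf p. H y g * pmf p y) * pmf q g)"
    by (subst sum.swap) (simp add: sum_distrib_right mult.assoc)
  also have "\<dots> = (\<Sum>g\<in>set_pmf q. measure_pmf.expectation p (\<lambda>y. H y g) * pmf q g)"
    using assms by (intro sum.cong refl arg_cong2[of _ _ _ _ "(*)"] integral_measure_pmf_real[symmetric]) auto
  also have "\<dots> = measure_pmf.expectation q (\<lambda>g. measure_pmf.expectation p (\<lambda>y. H y g))"
    using assms by (intro integral_measure_pmf_real[symmetric]) auto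
  finally show ?thesis .
qed

lemma finite_set_Pi_pmf:
  assumes "finite V" "\<And>v. v \<in> V \<Longrightarrow> finite (set_pmf (D v))"
  shows "finite (set_pmf (Pi_pmf V d D))"
  using assms by (subst set_Pi_pmf) auto

text \<open>Fubini: the value at \<open>v\<close> is independent of the others. The form
  \<open>F (c v) (c(v := d))\<close> separates the two, as the second argument has forgotten
  \<open>c v\<close>.\<close>

lemma expectation_resample:
  fixes F :: "'b \<Rightarrow> ('a \<Rightarrow> 'b) \<Rightarrow> real"
  assumes V: "finite V" "v \<in> V" and fin: "\<And>v. v \<in> V \<Longrightarrow> finite (set_pmf (D v))"
  shows "measure_pmf.expectation (Pi_pmf V d D) (\<lambda>c. F (c v) (c(v := d))) =
         measure_pmf.expectation (Pi_pmf V d D) (\<lambda>c. measure_pmf.expectation (D v) (\<lambda>x. F x (c(v := d))))"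
proof -
  define W where "W = V - {v}"
  have W: "V = insert v W" "finite W" "v \<notin> W" using V unfolding W_def by auto
  have finW: "finite (set_pmf (Pi_pmf W d D))" using W fin by (intro finite_set_Pi_pmf) auto
  have finv: "finite (set_pmf (D v))" using fin V by auto
  have eq: "measure_pmf.expectation (Pi_pmf V d D) (\<lambda>c. G (c v) (c(v := d))) =
     measure_pmf.expectation (Pi_pmf W d D) (\<lambda>g. measure_pmf.expectation (D v) (\<lambda>y. G y (g(v := d))))"
    for G :: "'b \<Rightarrow> ('a \<Rightarrow> 'b) \<Rightarrow> real"
    unfolding W(1) Pi_pmf_insert[OF W(2,3)]
    using expectation_pair_pmf[OF finv finW, of "\<lambda>y g. G y (g(v := d))"]
    by (simp add: case_prod_unfold)
  \<comment> \<open>The first instance evaluates the left side; the second one, which ignores its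
    first argument, evaluates the right side.\<close>
  show ?thesis
    using eq[of F] eq[of "\<lambda>_ c. measure_pmf.expectation (D v) (\<lambda>x. F x c)"] by simp
qed

lemma expectation_sum_pmf:
  fixes F :: "'b \<Rightarrow> 'a \<Rightarrow> real"
  assumes "finite (set_pmf p)"
  shows "measure_pmf.expectation p (\<lambda>x. \<Sum>i\<in>I. F i x) = (\<Sum>i\<in>I. measure_pmf.expectation p (F i))"
  using assms by (intro Bochner_Integration.integral_sum integrable_measure_pmf_finite)

lemma prob_Int_le_card:
  assumes "finite J" "\<And>j. j \<in> J \<Longrightarrow> measure_pmf.prob p {L. j \<in> L} \<le> \<alpha>"
  shows "measure_pmf.prob p {L. L \<inter> J \<noteq> {}} \<le> \<alpha> * real (card J)"
proof -
  have "measure_pmf.prob p {L. L \<inter> J \<noteq> {}} = measure_pmf.prob p (\<Union>j\<in>J. {L. j \<in> L})"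
    by (intro arg_cong[of _ _ "measure_pmf.prob p"]) auto
  also have "\<dots> \<le> (\<Sum>j\<in>J. measure_pmf.prob p {L. j \<in> L})"
    using assms by (intro measure_pmf.finite_measure_subadditive_finite) auto
  also have "\<dots> \<le> (\<Sum>j\<in>J. \<alpha>)" using assms by (intro sum_mono) auto
  finally show ?thesis by (simp add: mult.commute)
qed

section \<open>Points with independent random labels and their exposure\<close>

locale random_labels =
  fixes V :: "nat set" and k f :: nat and D :: "nat \<Rightarrow> nat set pmf"
  assumes finV: "finite V" and f2: "2 \<le> f"
    and finD: "\<And>v. v \<in> V \<Longrightarrow> finite (set_pmf (D v))"
    and le1: "\<And>v L. v \<in> V \<Longrightarrow> L \<in> set_pmf (D v) \<Longrightarrow> finite L \<and> card L \<le> 1"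
    and spread: "\<And>v j. v \<in> V \<Longrightarrow> measure_pmf.prob (D v) {L. j \<in> L} \<le> 1 / real f"
begin

abbreviation P :: "(nat \<Rightarrow> nat set) pmf" where "P \<equiv> Pi_pmf V {} D"

abbreviation E :: "((nat \<Rightarrow> nat set) \<Rightarrow> real) \<Rightarrow> real" where
  "E \<equiv> measure_pmf.expectation P"

text \<open>With half of \<open>f\<close>, the union bound shows that the label of a point misses
  any \<open>m\<close> given labels with probability at least 1/2.\<close>

definition m :: nat where "m = f div 2"

text \<open>
  The first queries that meet \<open>v\<close> in the run in which \<open>v\<close> has no label and so is close to no
  other point. They, and the labels \<open>J\<close> of their other ends, are independent of the label of \<open>v\<close>.
\<close>

definition early :: "query_tree \<Rightarrow> nat \<Rightarrow> (nat \<Rightarrow> nat set) \<Rightarrow> (nat \<times> nat) list" where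
  "early tr v c = take m (filter (meets v) (path tr (wt k (c(v := {})))))"

definition X :: "query_tree \<Rightarrow> nat \<Rightarrow> (nat \<Rightarrow> nat set) \<Rightarrow> nat" where
  "X tr v c = length (early tr v c)"

definition J :: "query_tree \<Rightarrow> nat \<Rightarrow> (nat \<Rightarrow> nat set) \<Rightarrow> nat set" where
  "J tr v c = (\<Union>e\<in>set (early tr v c). c (partner v e))"

lemma m_pos: "0 < m" using f2 unfolding m_def by simp

lemma finP: "finite (set_pmf P)"
  using finV finD by (intro finite_set_Pi_pmf)

lemma support:
  assumes "c \<in> set_pmf P"
  shows "finite (c x)" "card (c x) \<le> 1"
  using assms le1[of x "c x"] finV by (auto simp: set_Pi_pmf PiE_dflt_def, (cases "x \<in> V"; force)+)

lemma early_upd: "early tr v (c(v := y)) = early tr v c"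
  unfolding early_def by simp

lemma X_upd: "X tr v (c(v := y)) = X tr v c"
  unfolding X_def by (simp add: early_upd)

text \<open>A query that meets \<open>v\<close> has a partner different from \<open>v\<close>, so
  \<open>J\<close> never reads the altered coordinate.\<close>

lemma J_upd: "J tr v (c(v := y)) = J tr v c"
  unfolding J_def early_upd by (intro SUP_cong refl) (auto simp: early_def partner_neq dest!: in_set_takeD)

lemma card_J:
  assumes "c \<in> set_pmf P"
  shows "finite (J tr v c)" "card (J tr v c) \<le> X tr v c"
proof -
  show "finite (J tr v c)" unfolding J_def using support[OF assms] by auto
  have "card (J tr v c) \<le> (\<Sum>e\<in>set (early tr v c). card (c (partner v e)))"
    unfolding J_def by (rule card_UN_le) simp
  also have "\<dots> \<le> (\<Sum>e\<in>set (early tr v c). 1)" using support[OF assms] by (intro sum_mono) auto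
  also have "\<dots> \<le> X tr v c" unfolding X_def using card_length by auto
  finally show "card (J tr v c) \<le> X tr v c" .
qed

lemma X_le_m: "X tr v c \<le> m"
  unfolding X_def early_def by simp

text \<open>If the label of \<open>v\<close> misses \<open>J\<close>, every early query is answered
  2, as if \<open>v\<close> had no label, and \<open>path_truncated\<close> applies. When
  \<open>X < m\<close>, nothing was cut off and the runs coincide.\<close>

lemma unhit_run:
  assumes "c v \<inter> J tr v c = {}"
  shows "X tr v c \<le> degree_in v (path tr (wt k c))"
    and "X tr v c < m \<Longrightarrow> path tr (wt k c) = path tr (wt k (c(v := {}))) \<and>
           degree_in v (path tr (wt k c)) = X tr v c"
proof -
  let ?w' = "wt k (c(v := {}))"
  have X: "X tr v c = min m (degree_in v (path tr ?w'))"
    unfolding X_def early_def degree_in_def by simp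
  have off: "wt k c x y = ?w' x y" if "\<not> meets v (x, y)" for x y
    using that unfolding meets_def wt_def by auto
  have agree: "wt k c x y = ?w' x y" if xy: "(x, y) \<in> set (take m (filter (meets v) (path tr ?w')))" for x y
  proof -
    have e: "(x, y) \<in> set (early tr v c)" using xy unfolding early_def .
    then have "c (partner v (x, y)) \<subseteq> J tr v c" unfolding J_def by blast
    then have "c v \<inter> c (partner v (x, y)) = {}" using assms by blast
    moreover have "meets v (x, y)" using in_set_takeD[OF xy] by simp
    ultimately show ?thesis unfolding wt_def meets_def partner_def by (auto split: if_splits)
  qed
  have *: "min m (degree_in v (path tr ?w')) \<le> degree_in v (path tr (wt k c)) \<and>
         (degree_in v (path tr ?w') \<le> m \<longrightarrow> path tr (wt k c) = path tr ?w')"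
    by (rule path_truncated) (fact off, fact agree)
  then show "X tr v c \<le> degree_in v (path tr (wt k c))" using X by simp
  show "path tr (wt k c) = path tr ?w' \<and> degree_in v (path tr (wt k c)) = X tr v c"
    if "X tr v c < m" using * that X by auto
qed

lemma E_resample:
  assumes "v \<in> V"
  shows "E (\<lambda>c. F (c v) (c(v := {}))) =
         E (\<lambda>c. measure_pmf.expectation (D v) (\<lambda>x. F x (c(v := {}))))"
  using assms finV finD by (intro expectation_resample)

text \<open>The label of \<open>v\<close> is independent of \<open>X\<close> and \<open>J\<close>
  and misses \<open>J\<close> with probability at least 1/2; on that event \<open>X\<close> bounds
  the actual degree from below.\<close>

lemma E_X_le_degree:
  assumes v: "v \<in> V"
  shows "E (\<lambda>c. real (X tr v c)) \<le> 2 * E (\<lambda>c. real (degree_in v (path tr (wt k c))))"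
proof -
  have half: "1 / 2 \<le> measure_pmf.prob (D v) {x. x \<inter> J tr v c = {}}" if c: "c \<in> set_pmf P" for c
  proof -
    have "measure_pmf.prob (D v) {x. x \<inter> J tr v c \<noteq> {}} \<le> 1 / real f * real (card (J tr v c))"
      by (rule prob_Int_le_card) (use card_J[OF c] spread v in auto)
    also have "\<dots> \<le> 1 / real f * real m"
      using card_J(2)[OF c, of tr v] X_le_m[of tr v c] by (intro mult_left_mono) auto
    also have "\<dots> \<le> 1 / 2" using f2 unfolding m_def by (simp add: field_simps)
    finally have "measure_pmf.prob (D v) {x. x \<inter> J tr v c \<noteq> {}} \<le> 1 / 2" .
    moreover have "measure_pmf.prob (D v) {x. x \<inter> J tr v c \<noteq> {}} =
        1 - measure_pmf.prob (D v) {x. x \<inter> J tr v c = {}}"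
      using measure_pmf.prob_compl[of "{x. x \<inter> J tr v c = {}}" "D v"] by (simp add: Compl_eq_Diff_UNIV[symmetric] Collect_neg_eq)
    ultimately show ?thesis by simp
  qed
  have "E (\<lambda>c. real (X tr v c)) / 2 = E (\<lambda>c. 1 / 2 * real (X tr v c))" by simp
  also have "\<dots> \<le> E (\<lambda>c. measure_pmf.prob (D v) {x. x \<inter> J tr v c = {}} * real (X tr v c))"
    using half by (intro expectation_mono_supp[OF finP] mult_right_mono) auto
  also have "\<dots> = E (\<lambda>c. of_bool (c v \<inter> J tr v c = {}) * real (X tr v c))"
    using E_resample[OF v, of "\<lambda>x c. of_bool (x \<inter> J tr v c = {}) * real (X tr v c)"]
    by (simp add: J_upd X_upd expectation_of_bool)
  also have "\<dots> \<le> E (\<lambda>c. real (degree_in v (path tr (wt k c))))"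
    using unhit_run(1) by (intro expectation_mono_supp[OF finP]) auto
  finally show ?thesis by simp
qed

text \<open>The factor 4 is the 2 of \<open>E_X_le_degree\<close> times the 2 ends of a
  query.\<close>

lemma sum_E_X_le:
  assumes q: "\<And>c. c \<in> set_pmf P \<Longrightarrow> real (num_queries tr (wt k c)) \<le> q"
  shows "(\<Sum>v\<in>V. E (\<lambda>c. real (X tr v c))) \<le> 4 * q"
proof -
  have "(\<Sum>v\<in>V. E (\<lambda>c. real (X tr v c))) \<le> (\<Sum>v\<in>V. 2 * E (\<lambda>c. real (degree_in v (path tr (wt k c)))))"
    by (intro sum_mono E_X_le_degree)
  also have "\<dots> = 2 * E (\<lambda>c. \<Sum>v\<in>V. real (degree_in v (path tr (wt k c))))"
    by (simp add: sum_distrib_left[symmetric] expectation_sum_pmf[OF finP])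
  also have "\<dots> \<le> 2 * E (\<lambda>c. 2 * q)"
  proof (intro mult_left_mono expectation_mono_supp[OF finP])
    fix c assume c: "c \<in> set_pmf P"
    have "(\<Sum>v\<in>V. real (degree_in v (path tr (wt k c)))) \<le> 2 * real (length (path tr (wt k c)))"
      using sum_degree_in_le[OF finV, of "path tr (wt k c)"] by (simp flip: of_nat_sum)
    then show "(\<Sum>v\<in>V. real (degree_in v (path tr (wt k c)))) \<le> 2 * q"
      using q[OF c] by (simp add: length_path)
  qed simp
  finally show ?thesis by simp
qed

text \<open>\<open>X\<close> does not depend on the label of \<open>v\<close>, so the expectation
  factors.\<close>

lemma E_labelled_X:
  assumes v: "v \<in> V"
  shows "E (\<lambda>c. of_bool (c v \<inter> A \<noteq> {}) * real (X tr v c)) =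
         measure_pmf.prob (D v) {L. L \<inter> A \<noteq> {}} * E (\<lambda>c. real (X tr v c))"
  using E_resample[OF v, of "\<lambda>x c. of_bool (x \<inter> A \<noteq> {}) * real (X tr v c)"]
  by (simp add: X_upd expectation_of_bool)

text \<open>The event that the run may depend on the label of \<open>v\<close>: the label was hit,
  or the truncation was reached. \<open>A\<close> will be \<open>{..<h}\<close> for terminals and
  \<open>UNIV\<close> for non-terminals.\<close>

definition exposed :: "nat set \<Rightarrow> query_tree \<Rightarrow> nat \<Rightarrow> (nat \<Rightarrow> nat set) \<Rightarrow> bool" where
  "exposed A tr v c \<longleftrightarrow> c v \<inter> A \<noteq> {} \<and> (c v \<inter> J tr v c \<noteq> {} \<or> X tr v c = m)"

lemma unexposed_run:
  assumes "\<not> exposed A tr v c" "c v \<inter> A \<noteq> {}"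
  shows "path tr (wt k c) = path tr (wt k (c(v := {})))" "degree_in v (path tr (wt k c)) = X tr v c"
    "c v \<inter> J tr v c = {}" "X tr v c < m"
proof -
  show d: "c v \<inter> J tr v c = {}" and l: "X tr v c < m"
    using assms X_le_m[of tr v c] unfolding exposed_def by auto
  show "path tr (wt k c) = path tr (wt k (c(v := {})))" "degree_in v (path tr (wt k c)) = X tr v c"
    using unhit_run(2)[of c v tr, OF d l] by auto
qed

text \<open>Each of the at most \<open>X\<close> labels in \<open>J \<inter> A\<close> is hit with
  probability at most \<open>\<alpha>\<close>. The event \<open>X = m\<close> is charged
  \<open>X / m\<close>, and independence of \<open>X\<close> from the label of \<open>v\<close>
  contributes the factor \<open>\<beta>\<close>.\<close>

lemma prob_exposed_le:
  assumes v: "v \<in> V" and \<alpha>: "\<And>j. j \<in> A \<Longrightarrow> measure_pmf.prob (D v) {L. j \<in> L} \<le> \<alpha>" "0 \<le> \<alpha>"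
    and \<beta>: "measure_pmf.prob (D v) {L. L \<inter> A \<noteq> {}} \<le> \<beta>"
  shows "E (\<lambda>c. of_bool (exposed A tr v c)) \<le> (\<alpha> + \<beta> / real m) * E (\<lambda>c. real (X tr v c))"
proof -
  have "E (\<lambda>c. of_bool (exposed A tr v c)) \<le>
      E (\<lambda>c. of_bool (c v \<inter> (J tr v c \<inter> A) \<noteq> {}) + of_bool (c v \<inter> A \<noteq> {}) * real (X tr v c) / real m)"
  proof (rule expectation_mono_supp[OF finP])
    fix c assume c: "c \<in> set_pmf P"
    show "(of_bool (exposed A tr v c) :: real) \<le>
       of_bool (c v \<inter> (J tr v c \<inter> A) \<noteq> {}) + of_bool (c v \<inter> A \<noteq> {}) * real (X tr v c) / real m"
    proof (cases "exposed A tr v c")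
      case True
      then have a: "c v \<inter> A \<noteq> {}" and "c v \<inter> J tr v c \<noteq> {} \<or> X tr v c = m"
        unfolding exposed_def by auto
      then consider "c v \<inter> J tr v c \<noteq> {}" | "X tr v c = m" by blast
      then show ?thesis
      proof cases
        case 1
        \<comment> \<open>With a single label, \<open>v\<close> meets \<open>A\<close> and
          \<open>J\<close> in the same label; hence the union bound may range over
          \<open>J \<inter> A\<close> only.\<close>
        have "\<exists>i. c v = {i}" using support[OF c, of v] a
          by (metis Int_empty_left card_1_singletonE card_0_eq le_Suc_eq le_zero_eq One_nat_def)
        then have "c v \<inter> (J tr v c \<inter> A) \<noteq> {}" using 1 a by auto
        then show ?thesis by simp
      next
        case 2
        then show ?thesis using a m_pos by simp
      qed
    qed simp
  qed
  also have "\<dots> = E (\<lambda>c. of_bool (c v \<inter> (J tr v c \<inter> A) \<noteq> {})) +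
      E (\<lambda>c. of_bool (c v \<inter> A \<noteq> {}) * real (X tr v c)) / real m"
    by (subst Bochner_Integration.integral_add) (auto intro!: integrable_measure_pmf_finite finP)
  also have "E (\<lambda>c. of_bool (c v \<inter> A \<noteq> {}) * real (X tr v c)) / real m \<le> \<beta> / real m * E (\<lambda>c. real (X tr v c))"
    unfolding E_labelled_X[OF v] using \<beta> by (auto intro!: divide_right_mono mult_right_mono integral_nonneg_AE)
  also have "E (\<lambda>c. of_bool (c v \<inter> (J tr v c \<inter> A) \<noteq> {})) =
      E (\<lambda>c. measure_pmf.prob (D v) {x. x \<inter> (J tr v c \<inter> A) \<noteq> {}})"
    using E_resample[OF v, of "\<lambda>x c. of_bool (x \<inter> (J tr v c \<inter> A) \<noteq> {})"]
    by (simp add: J_upd expectation_of_bool)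
  also have "\<dots> \<le> E (\<lambda>c. \<alpha> * real (X tr v c))"
  proof (rule expectation_mono_supp[OF finP])
    fix c assume c: "c \<in> set_pmf P"
    have "measure_pmf.prob (D v) {x. x \<inter> (J tr v c \<inter> A) \<noteq> {}} \<le> \<alpha> * real (card (J tr v c \<inter> A))"
      by (rule prob_Int_le_card) (use card_J[OF c] \<alpha> in auto)
    also have "\<dots> \<le> \<alpha> * real (X tr v c)"
      using card_J[OF c, of tr v] card_mono[of "J tr v c" "J tr v c \<inter> A"] \<alpha>(2)
      by (intro mult_left_mono) auto
    finally show "measure_pmf.prob (D v) {x. x \<inter> (J tr v c \<inter> A) \<noteq> {}} \<le> \<alpha> * real (X tr v c)" .
  qed
  finally show ?thesis by (simp add: algebra_simps)
qed

end

section \<open>Comparing the likelihood of runs\<close>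

definition asked :: "nat \<Rightarrow> query_tree \<Rightarrow> (nat \<Rightarrow> nat set) \<Rightarrow> nat \<Rightarrow> nat set" where
  "asked k tr c u = {t. t < k \<and> ((t, u) \<in> set (path tr (wt k c)) \<or> (u, t) \<in> set (path tr (wt k c)))}"

definition asked_labels :: "nat \<Rightarrow> query_tree \<Rightarrow> (nat \<Rightarrow> nat set) \<Rightarrow> nat \<Rightarrow> nat set" where
  "asked_labels k tr c u = (\<Union>t\<in>asked k tr c u. c t)"

text \<open>Labellings that agree with \<open>c\<close> on what the run and the terminal labels
  reveal. Distances between terminals are fixed by their labels and those between non-terminals do
  not depend on labels, so only mixed queries constrain \<open>c' u\<close>.\<close>

definition indist :: "nat \<Rightarrow> nat \<Rightarrow> query_tree \<Rightarrow> (nat \<Rightarrow> nat set) \<Rightarrow> (nat \<Rightarrow> nat set) set" where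
  "indist k n tr c = {c'. (\<forall>t<k. c' t = c t) \<and>
     (\<forall>u\<in>{k..<n}. c' u \<inter> asked_labels k tr c u = c u \<inter> asked_labels k tr c u)}"

text \<open>In a mixed query the labels of the terminal are among the asked labels, where
  \<open>c\<close> and \<open>c'\<close> have the same trace at the non-terminal.\<close>

lemma indist_same_run:
  assumes tr: "queries_within {..<n} tr" and c': "c' \<in> indist k n tr c"
  shows "path tr (wt k c') = path tr (wt k c)" "result tr (wt k c') = result tr (wt k c)"
proof -
  have "wt k c' x y = wt k c x y" if xy: "(x, y) \<in> set (path tr (wt k c))" for x y
  proof -
    have n: "x < n" "y < n" using path_within[OF tr] xy by auto
    have T: "c' t = c t" if "t < k" for t using c' that unfolding indist_def by auto
    have Y: "c' u \<inter> asked_labels k tr c u = c u \<inter> asked_labels k tr c u" if "k \<le> u" "u < n" for u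
      using c' that unfolding indist_def by auto
    consider "x < k" "y < k" | "k \<le> x" "k \<le> y" | "x < k" "k \<le> y" | "k \<le> x" "y < k" by linarith
    then show ?thesis
    proof cases
      case 3
      have "c x \<subseteq> asked_labels k tr c y" using xy 3 unfolding asked_labels_def asked_def by blast
      then have "c x \<inter> c' y = {} \<longleftrightarrow> c x \<inter> c y = {}" using Y[of y] 3 n by blast
      then show ?thesis unfolding wt_def using T 3 by auto
    next
      case 4
      have "c y \<subseteq> asked_labels k tr c x" using xy 4 unfolding asked_labels_def asked_def by blast
      then have "c' x \<inter> c y = {} \<longleftrightarrow> c x \<inter> c y = {}" using Y[of x] 4 n by blast
      then show ?thesis unfolding wt_def using T 4 by auto
    qed (auto simp: wt_def T)
  qed
  from path_result_agree[OF this]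
  show "path tr (wt k c') = path tr (wt k c)" "result tr (wt k c') = result tr (wt k c)" by auto
qed

text \<open>Asked labels depend only on the run and the terminal labels, which are common to the
  class. Hence the classes partition the labellings.\<close>

lemma indist_eq:
  assumes tr: "queries_within {..<n} tr" and c': "c' \<in> indist k n tr c"
  shows "indist k n tr c' = indist k n tr c"
proof -
  have T: "c' t = c t" if "t < k" for t using c' that unfolding indist_def by auto
  have "asked k tr c' = asked k tr c" unfolding asked_def indist_same_run(1)[OF assms] ..
  then have "asked_labels k tr c' u = asked_labels k tr c u" for u
    unfolding asked_labels_def using T by (auto simp: asked_def)
  with c' show ?thesis unfolding indist_def by auto
qed

lemma indist_refl: "c \<in> indist k n tr c"
  unfolding indist_def by simp

text \<open>For fixed \<open>c\<close> the class constrains each point separately, so it is a box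
  for the product measure.\<close>

lemma prob_indist:
  assumes "k \<le> n"
  shows "measure_pmf.prob (Pi_pmf {..<n} {} D) (indist k n tr c) =
    (\<Prod>t<k. measure_pmf.prob (D t) {c t}) *
    (\<Prod>u\<in>{k..<n}. measure_pmf.prob (D u) {L. L \<inter> asked_labels k tr c u = c u \<inter> asked_labels k tr c u})"
proof -
  define B where "B x = (if x < k then {c x}
      else {L. L \<inter> asked_labels k tr c x = c x \<inter> asked_labels k tr c x})" for x
  have "indist k n tr c = Pi {..<n} B"
    using assms unfolding indist_def Pi_def B_def by (auto split: if_splits)
  then have "measure_pmf.prob (Pi_pmf {..<n} {} D) (indist k n tr c) =
      (\<Prod>x\<in>{..<n}. measure_pmf.prob (D x) (B x))"
    by (simp add: measure_Pi_pmf_Pi)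
  also have "\<dots> = (\<Prod>x\<in>{..<k} \<union> {k..<n}. measure_pmf.prob (D x) (B x))"
    using assms by (intro prod.cong) auto
  also have "\<dots> = (\<Prod>x<k. measure_pmf.prob (D x) (B x)) * (\<Prod>x\<in>{k..<n}. measure_pmf.prob (D x) (B x))"
    by (intro prod.union_disjoint) auto
  finally show ?thesis by (simp add: B_def)
qed

text \<open>Measures the loss of likelihood: a non-terminal with a hit could, as a hub, carry
  further asked labels. Non-terminals without a hit lose nothing. A label below \<open>h\<close>
  that was hit is itself counted.\<close>

definition near :: "nat \<Rightarrow> nat \<Rightarrow> nat \<Rightarrow> query_tree \<Rightarrow> (nat \<Rightarrow> nat set) \<Rightarrow> nat" where
  "near k n h tr c = (\<Sum>u\<in>{k..<n}. if c u \<inter> asked_labels k tr c u = {} then 0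
                                      else card (asked_labels k tr c u \<inter> {..<h}))"

text \<open>The Weierstrass product inequality.\<close>

lemma one_minus_sum_le_prod:
  fixes z :: "'a \<Rightarrow> real"
  assumes "finite I" "\<And>i. i \<in> I \<Longrightarrow> 0 \<le> z i \<and> z i \<le> 1"
  shows "1 - sum z I \<le> (\<Prod>i\<in>I. 1 - z i)"
  using assms
proof (induction I rule: finite_induct)
  case (insert x F)
  have "(\<Prod>i\<in>F. 1 - z i) \<le> 1" using insert.prems by (intro prod_le_1) auto
  then have "(\<Prod>i\<in>F. 1 - z i) - z x \<le> (\<Prod>i\<in>F. 1 - z i) - z x * (\<Prod>i\<in>F. 1 - z i)"
    using insert.prems[of x] mult_left_le[of "\<Prod>i\<in>F. 1 - z i" "z x"] by simp
  also have "\<dots> = (\<Prod>i\<in>insert x F. 1 - z i)" using insert.hyps by (simp add: algebra_simps)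
  finally show ?case using insert by simp
qed simp

text \<open>The terminal factors agree, and each non-terminal loses a factor \<open>1 - z u\<close>,
  where the \<open>z u\<close> sum to at most 1/2.\<close>

lemma prob_indist_compare:
  assumes kn: "k \<le> n" and \<kappa>: "0 \<le> \<kappa>"
    and T: "\<And>t. t < k \<Longrightarrow> D' t = D t"
    and Y: "\<And>u. u \<in> {k..<n} \<Longrightarrow>
      (1 - \<kappa> * real (if c u \<inter> asked_labels k tr c u = {} then 0 else card (asked_labels k tr c u \<inter> {..<h})))
        * measure_pmf.prob (D u) {L. L \<inter> asked_labels k tr c u = c u \<inter> asked_labels k tr c u}
      \<le> measure_pmf.prob (D' u) {L. L \<inter> asked_labels k tr c u = c u \<inter> asked_labels k tr c u}"
    and near: "\<kappa> * real (near k n h tr c) \<le> 1 / 2"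
  shows "measure_pmf.prob (Pi_pmf {..<n} {} D) (indist k n tr c)
    \<le> 2 * measure_pmf.prob (Pi_pmf {..<n} {} D') (indist k n tr c)"
proof -
  define z where "z u = \<kappa> * real (if c u \<inter> asked_labels k tr c u = {} then 0
      else card (asked_labels k tr c u \<inter> {..<h}))" for u
  define R where "R u = {L. L \<inter> asked_labels k tr c u = c u \<inter> asked_labels k tr c u}" for u
  have z0: "0 \<le> z u" for u unfolding z_def using \<kappa> by simp
  have sz: "sum z {k..<n} \<le> 1 / 2"
    using near unfolding near_def z_def of_nat_sum sum_distrib_left .
  have z1: "z u \<le> 1" if "u \<in> {k..<n}" for u
    using member_le_sum[of u "{k..<n}" z] that sz z0 by auto
  let ?a = "\<Prod>t<k. measure_pmf.prob (D t) {c t}"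
  let ?p = "\<lambda>D. \<Prod>u\<in>{k..<n}. measure_pmf.prob (D u) (R u)"
  have "1 / 2 * ?p D \<le> (\<Prod>u\<in>{k..<n}. 1 - z u) * ?p D"
  proof (intro mult_right_mono prod_nonneg)
    show "1 / 2 \<le> (\<Prod>u\<in>{k..<n}. 1 - z u)"
      using one_minus_sum_le_prod[of "{k..<n}" z] z0 z1 sz by simp
  qed auto
  also have "\<dots> = (\<Prod>u\<in>{k..<n}. (1 - z u) * measure_pmf.prob (D u) (R u))"
    by (simp add: prod.distrib)
  also have "\<dots> \<le> ?p D'"
    using z1 Y unfolding z_def R_def by (intro prod_mono) auto
  finally have "?p D \<le> 2 * ?p D'" by simp
  then have "?a * ?p D \<le> ?a * (2 * ?p D')" by (intro mult_left_mono prod_nonneg) auto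
  moreover have "?a = (\<Prod>t<k. measure_pmf.prob (D' t) {c t})" using T by simp
  ultimately show ?thesis unfolding prob_indist[OF kn] R_def by simp
qed

text \<open>The comparison is summed over the finitely many classes of points of \<open>S\<close> in
  the support. They are disjoint and lie entirely in \<open>S'\<close>, though they may stick out of
  \<open>S\<close>.\<close>

lemma prob_le_by_classes:
  fixes p p' :: "'a pmf"
  assumes fin: "finite (set_pmf p)"
    and S: "\<And>c. c \<in> S \<Longrightarrow> c \<in> set_pmf p \<Longrightarrow> c \<in> cls c \<and> cls c \<subseteq> S' \<and>
                 measure_pmf.prob p (cls c) \<le> 2 * measure_pmf.prob p' (cls c)"
    and eq: "\<And>c c'. c' \<in> cls c \<Longrightarrow> cls c' = cls c"
  shows "measure_pmf.prob p S \<le> 2 * measure_pmf.prob p' S'"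
proof -
  define \<C> where "\<C> = cls ` (S \<inter> set_pmf p)"
  have fin\<C>: "finite \<C>" using fin unfolding \<C>_def by simp
  have disj: "disjoint_family_on (\<lambda>C. C) \<C>"
    unfolding disjoint_family_on_def \<C>_def using eq by blast
  have "measure_pmf.prob p S = measure_pmf.prob p (S \<inter> set_pmf p)"
    by (simp add: measure_Int_set_pmf)
  also have "\<dots> \<le> measure_pmf.prob p (\<Union>C\<in>\<C>. C)"
    using S unfolding \<C>_def by (intro measure_pmf.finite_measure_mono) auto
  also have "\<dots> = (\<Sum>C\<in>\<C>. measure_pmf.prob p C)"
    using fin\<C> disj by (intro measure_pmf.finite_measure_finite_Union) auto
  also have "\<dots> \<le> (\<Sum>C\<in>\<C>. 2 * measure_pmf.prob p' C)"
    using S unfolding \<C>_def by (intro sum_mono) auto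
  also have "\<dots> = 2 * measure_pmf.prob p' (\<Union>C\<in>\<C>. C)"
    using fin\<C> disj by (subst measure_pmf.finite_measure_finite_Union) (auto simp: sum_distrib_left)
  also have "\<dots> \<le> 2 * measure_pmf.prob p' S'"
    using S unfolding \<C>_def by (intro mult_left_mono measure_pmf.finite_measure_mono) auto
  finally show ?thesis .
qed

section \<open>Events at a single non-terminal\<close>

lemma prob_single_label_inter:
  assumes h: "0 < h"
  shows "g < h \<Longrightarrow> g \<in> Q \<Longrightarrow>
      measure_pmf.prob (map_pmf (\<lambda>i. {i}) (pmf_of_set {..<h})) {L. L \<inter> Q = {g}} = 1 / real h"
    and "measure_pmf.prob (map_pmf (\<lambda>i. {i}) (pmf_of_set {..<h})) {L. L \<inter> Q = {}} =
      1 - real (card (Q \<inter> {..<h})) / real h"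
    and "measure_pmf.prob (map_pmf (\<lambda>i. {i}) (pmf_of_set {..<h})) {L. j \<in> L} =
      (if j < h then 1 / real h else 0)"
proof -
  have u: "measure_pmf.prob (map_pmf (\<lambda>i. {i}) (pmf_of_set {..<h})) S =
      real (card ({..<h} \<inter> {i. {i} \<in> S})) / real h" for S :: "nat set set"
  proof -
    have ne: "{..<h} \<noteq> {}" using h by (simp add: lessThan_empty_iff)
    have "measure_pmf.prob (map_pmf (\<lambda>i. {i}) (pmf_of_set {..<h})) S =
        measure_pmf.prob (pmf_of_set {..<h}) {i. {i} \<in> S}"
      by (simp only: measure_map_pmf vimage_def)
    also have "\<dots> = real (card ({..<h} \<inter> {i. {i} \<in> S})) / real h"
      using measure_pmf_of_set[OF ne finite_lessThan, of "{i. {i} \<in> S}"] by simp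
    finally show ?thesis .
  qed
  show "measure_pmf.prob (map_pmf (\<lambda>i. {i}) (pmf_of_set {..<h})) {L. L \<inter> Q = {g}} = 1 / real h"
    if "g < h" "g \<in> Q"
  proof -
    have "{i} \<inter> Q = {g} \<longleftrightarrow> i = g" for i using that by (cases "i \<in> Q") auto
    then have "{..<h} \<inter> {i. {i} \<in> {L. L \<inter> Q = {g}}} = {g}" using that(1) by auto
    then show ?thesis unfolding u by simp
  qed
  have "{..<h} \<inter> {i. {i} \<in> {L. L \<inter> Q = {}}} = {..<h} - (Q \<inter> {..<h})" by auto
  moreover have "card ({..<h} - (Q \<inter> {..<h})) = h - card (Q \<inter> {..<h})"
    by (subst card_Diff_subset) auto
  moreover have "card (Q \<inter> {..<h}) \<le> h" using card_mono[of "{..<h}" "Q \<inter> {..<h}"] by auto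
  ultimately show "measure_pmf.prob (map_pmf (\<lambda>i. {i}) (pmf_of_set {..<h})) {L. L \<inter> Q = {}} =
      1 - real (card (Q \<inter> {..<h})) / real h"
    unfolding u using h by (simp add: field_simps)
  have "{..<h} \<inter> {i. {i} \<in> {L. j \<in> L}} = (if j < h then {j} else {})" by auto
  then show "measure_pmf.prob (map_pmf (\<lambda>i. {i}) (pmf_of_set {..<h})) {L. j \<in> L} =
      (if j < h then 1 / real h else 0)"
    unfolding u by simp
qed

text \<open>
  If all labels have the same probability as under the uniform single label, an empty
  intersection only gets more likely, by the union bound; a one-element intersection loses
  at most the probability of a second common label.
\<close>

lemma prob_inter_ge_single_label:
  fixes p :: "nat set pmf"
  assumes h: "0 < h" and Q: "finite Q" and g: "g < h"
    and marg: "\<And>i. i < h \<Longrightarrow> measure_pmf.prob p {L. i \<in> L} = 1 / real h"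
    and pair: "\<And>i j. i < h \<Longrightarrow> j < h \<Longrightarrow> i \<noteq> j \<Longrightarrow> measure_pmf.prob p {L. i \<in> L \<and> j \<in> L} \<le> \<kappa> / real h"
    and null: "\<And>i. i \<in> Q \<Longrightarrow> h \<le> i \<Longrightarrow> measure_pmf.prob p {L. i \<in> L} = 0"
    and \<kappa>: "0 \<le> \<kappa>"
  shows "(1 - \<kappa> * real (if {g} \<inter> Q = {} then 0 else card (Q \<inter> {..<h})))
           * measure_pmf.prob (map_pmf (\<lambda>i. {i}) (pmf_of_set {..<h})) {L. L \<inter> Q = {g} \<inter> Q}
         \<le> measure_pmf.prob p {L. L \<inter> Q = {g} \<inter> Q}"
proof (cases "g \<in> Q")
  case False
  have "measure_pmf.prob p {L. L \<inter> Q \<noteq> {}} \<le> measure_pmf.prob p (\<Union>i\<in>Q. {L. i \<in> L})"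
    by (intro measure_pmf.finite_measure_mono) auto
  also have "\<dots> \<le> (\<Sum>i\<in>Q. measure_pmf.prob p {L. i \<in> L})"
    using Q by (intro measure_pmf.finite_measure_subadditive_finite) auto
  also have "\<dots> = (\<Sum>i\<in>Q \<inter> {..<h}. measure_pmf.prob p {L. i \<in> L})"
    using Q null by (intro sum.mono_neutral_right) (auto, metis linorder_not_less)
  also have "\<dots> = real (card (Q \<inter> {..<h})) / real h" using marg by simp
  finally have "measure_pmf.prob p {L. L \<inter> Q \<noteq> {}} \<le> real (card (Q \<inter> {..<h})) / real h" .
  moreover have "measure_pmf.prob p {L. L \<inter> Q \<noteq> {}} = 1 - measure_pmf.prob p {L. L \<inter> Q = {}}"
    using measure_pmf.prob_compl[of "{L. L \<inter> Q = {}}" p]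
    by (simp add: Compl_eq_Diff_UNIV[symmetric] Collect_neg_eq)
  ultimately show ?thesis using False prob_single_label_inter(2)[OF h, of Q] by simp
next
  case True
  have "1 / real h = measure_pmf.prob p {L. g \<in> L}" using marg g by simp
  also have "\<dots> \<le> measure_pmf.prob p ({L. L \<inter> Q = {g}} \<union> (\<Union>i\<in>Q - {g}. {L. g \<in> L \<and> i \<in> L}))"
    using True by (intro measure_pmf.finite_measure_mono) auto
  also have "\<dots> \<le> measure_pmf.prob p {L. L \<inter> Q = {g}} + measure_pmf.prob p (\<Union>i\<in>Q - {g}. {L. g \<in> L \<and> i \<in> L})"
    by (intro measure_Un_le) auto
  also have "measure_pmf.prob p (\<Union>i\<in>Q - {g}. {L. g \<in> L \<and> i \<in> L}) \<le> (\<Sum>i\<in>Q - {g}. measure_pmf.prob p {L. g \<in> L \<and> i \<in> L})"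
    using Q by (intro measure_pmf.finite_measure_subadditive_finite) auto
  also have "\<dots> \<le> (\<Sum>i\<in>Q - {g}. if i < h then \<kappa> / real h else 0)"
  proof (rule sum_mono)
    fix i assume i: "i \<in> Q - {g}"
    show "measure_pmf.prob p {L. g \<in> L \<and> i \<in> L} \<le> (if i < h then \<kappa> / real h else 0)"
    proof (cases "i < h")
      case False
      have "measure_pmf.prob p {L. g \<in> L \<and> i \<in> L} \<le> measure_pmf.prob p {L. i \<in> L}"
        by (intro measure_pmf.finite_measure_mono) auto
      then show ?thesis using False null i by simp
    qed (use pair g i in auto)
  qed
  also have "\<dots> = real (card ((Q - {g}) \<inter> {..<h})) * (\<kappa> / real h)"
    using Q by (simp add: sum.If_cases Int_def lessThan_def)
  also have "\<dots> \<le> real (card (Q \<inter> {..<h})) * (\<kappa> / real h)"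
    using Q \<kappa> by (intro mult_right_mono) (auto intro!: card_mono)
  finally have "1 / real h - real (card (Q \<inter> {..<h})) * (\<kappa> / real h) \<le> measure_pmf.prob p {L. L \<inter> Q = {g}}"
    by simp
  then show ?thesis using True prob_single_label_inter(1)[OF h g True] by (simp add: algebra_simps)
qed

text \<open>Labels are replaced by the terminals that carry them, which can only raise the count as
  each carries at most one. The resulting pairs can be charged to queries.\<close>

lemma near_le_card:
  assumes T: "\<And>t. t < k \<Longrightarrow> finite (c t) \<and> card (c t) \<le> 1"
  shows "near k n h tr c \<le> card (SIGMA u : {u \<in> {k..<n}. c u \<inter> asked_labels k tr c u \<noteq> {}}.
           {t \<in> asked k tr c u. c t \<inter> {..<h} \<noteq> {}})"
proof -
  let ?H = "{u \<in> {k..<n}. c u \<inter> asked_labels k tr c u \<noteq> {}}"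
  let ?N = "\<lambda>u. {t \<in> asked k tr c u. c t \<inter> {..<h} \<noteq> {}}"
  have fN: "finite (asked k tr c u)" for u unfolding asked_def by simp
  have "card (asked_labels k tr c u \<inter> {..<h}) \<le> card (?N u)" for u
  proof -
    have eq: "asked_labels k tr c u \<inter> {..<h} = (\<Union>t\<in>?N u. c t \<inter> {..<h})"
      unfolding asked_labels_def by auto
    have "card (asked_labels k tr c u \<inter> {..<h}) \<le> (\<Sum>t\<in>?N u. card (c t \<inter> {..<h}))"
      unfolding eq using fN[of u] by (intro card_UN_le) simp
    also have "\<dots> \<le> (\<Sum>t\<in>?N u. 1)"
    proof (rule sum_mono)
      fix t assume "t \<in> ?N u"
      then have "t < k" unfolding asked_def by auto
      then show "card (c t \<inter> {..<h}) \<le> 1" using T[of t] card_mono[of "c t" "c t \<inter> {..<h}"] by auto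
    qed
    finally show ?thesis by simp
  qed
  then have "near k n h tr c \<le> (\<Sum>u\<in>{k..<n}. if c u \<inter> asked_labels k tr c u = {} then 0 else card (?N u))"
    unfolding near_def by (intro sum_mono) auto
  also have "\<dots> = (\<Sum>u\<in>?H. card (?N u))"
    by (intro sum.mono_neutral_cong_right) auto
  also have "\<dots> = card (SIGMA u : ?H. ?N u)" using fN by (subst card_SigmaI) auto
  finally show ?thesis .
qed

text \<open>The crude bound, which suffices when \<open>n\<close> is at least k^(6/5).\<close>

lemma near_le_num_queries:
  assumes T: "\<And>t. t < k \<Longrightarrow> finite (c t) \<and> card (c t) \<le> 1"
  shows "near k n h tr c \<le> num_queries tr (wt k c)"
proof -
  let ?S = "SIGMA u : {u \<in> {k..<n}. c u \<inter> asked_labels k tr c u \<noteq> {}}.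
           {t \<in> asked k tr c u. c t \<inter> {..<h} \<noteq> {}}"
  let ?p = "path tr (wt k c)"
  \<comment> \<open>Terminals are smaller than non-terminals, so \<open>max\<close> and
    \<open>min\<close> recover the pair from either order of the query.\<close>
  have "?S \<subseteq> (\<lambda>(x, y). (max x y, min x y)) ` set ?p"
  proof
    fix z assume "z \<in> ?S"
    then obtain u t where "z = (u, t)" "k \<le> u" "t < k" "(t, u) \<in> set ?p \<or> (u, t) \<in> set ?p"
      unfolding asked_def by auto
    then show "z \<in> (\<lambda>(x, y). (max x y, min x y)) ` set ?p" by (force simp: image_iff)
  qed
  then have "card ?S \<le> card (set ?p)" by (meson List.finite_set card_image_le card_mono finite_imageI le_trans)
  also have "\<dots> \<le> num_queries tr (wt k c)" using card_length[of ?p] by (simp add: length_path)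
  finally show ?thesis using near_le_card[where k = k and c = c and n = n and h = h and tr = tr, OF T] by linarith
qed

section \<open>Charging the pairs counted by \<open>near\<close> to exposed points\<close>

context random_labels
begin

text \<open>Were \<open>u\<close> not exposed, all its queries would be early, so every asked label
  would lie in \<open>J\<close>, which the label of \<open>u\<close> misses. The first assumption
  excludes a terminal queried with itself; non-terminals satisfy it automatically.\<close>

lemma hit_exposed:
  assumes "u \<notin> asked k tr c u" and "c u \<inter> asked_labels k tr c u \<noteq> {}"
  shows "exposed UNIV tr u c"
proof (rule ccontr)
  assume ne: "\<not> exposed UNIV tr u c"
  have "c u \<inter> UNIV \<noteq> {}" using assms(2) by auto
  note r = unexposed_run[OF ne this]
  have "take m (filter (meets u) (path tr (wt k c))) = filter (meets u) (path tr (wt k c))"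
    using r(2,4) unfolding degree_in_def by simp
  then have early: "early tr u c = filter (meets u) (path tr (wt k c))"
    unfolding early_def r(1)[symmetric] .
  have "asked_labels k tr c u \<subseteq> J tr u c"
  proof
    fix i assume "i \<in> asked_labels k tr c u"
    then obtain t where t: "t \<in> asked k tr c u" "i \<in> c t" unfolding asked_labels_def by blast
    with assms(1) have tu: "t \<noteq> u" by auto
    from t(1) consider "(t, u) \<in> set (path tr (wt k c))" | "(u, t) \<in> set (path tr (wt k c))"
      unfolding asked_def by blast
    then show "i \<in> J tr u c"
    proof cases
      case 1
      with tu have "(t, u) \<in> set (early tr u c)" "partner u (t, u) = t"
        unfolding early meets_def partner_def by auto
      with t(2) show ?thesis unfolding J_def by (metis UN_I)
    next
      case 2
      with tu have "(u, t) \<in> set (early tr u c)" "partner u (u, t) = t"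
        unfolding early meets_def partner_def by auto
      with t(2) show ?thesis unfolding J_def by (metis UN_I)
    qed
  qed
  with r(3) assms(2) show False by blast
qed

definition exposed_terminals :: "nat \<Rightarrow> query_tree \<Rightarrow> (nat \<Rightarrow> nat set) \<Rightarrow> nat" where
  "exposed_terminals h tr c = card {t \<in> {..<k}. exposed {..<h} tr t c}"

definition exposed_others :: "nat \<Rightarrow> query_tree \<Rightarrow> (nat \<Rightarrow> nat set) \<Rightarrow> nat" where
  "exposed_others n tr c = card {u \<in> {k..<n}. exposed UNIV tr u c}"

text \<open>Exposed terminals are included in the sum, which keeps every summand a product of
  independent factors.\<close>

definition unexposed_weight :: "nat \<Rightarrow> query_tree \<Rightarrow> (nat \<Rightarrow> nat set) \<Rightarrow> real" where
  "unexposed_weight h tr c = (\<Sum>t<k. of_bool (c t \<inter> {..<h} \<noteq> {}) * real (X tr t c))"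

text \<open>In each counted pair the non-terminal is exposed by \<open>hit_exposed\<close>. The
  terminal is either exposed too, which gives the product, or has exactly \<open>X\<close> queries,
  which gives the additive term.\<close>

lemma near_le_exposed:
  assumes c: "c \<in> set_pmf P"
  shows "real (near k n h tr c) \<le>
    real (exposed_terminals h tr c) * real (exposed_others n tr c) + unexposed_weight h tr c"
proof -
  let ?H = "{u \<in> {k..<n}. c u \<inter> asked_labels k tr c u \<noteq> {}}"
  let ?N = "\<lambda>u. {t \<in> asked k tr c u. c t \<inter> {..<h} \<noteq> {}}"
  let ?O = "{u \<in> {k..<n}. exposed UNIV tr u c}"
  let ?E = "{t \<in> {..<k}. exposed {..<h} tr t c}"
  let ?U = "{t \<in> {..<k}. c t \<inter> {..<h} \<noteq> {} \<and> \<not> exposed {..<h} tr t c}"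
  let ?p = "path tr (wt k c)"
  let ?M = "\<lambda>t. (\<lambda>e. (partner t e, t)) ` set (filter (meets t) ?p)"
  have "(SIGMA u : ?H. ?N u) \<subseteq> ?O \<times> ?E \<union> (\<Union>t\<in>?U. ?M t)"
  proof
    fix z assume "z \<in> (SIGMA u : ?H. ?N u)"
    then obtain u t where z: "z = (u, t)" "u \<in> ?H" "t \<in> ?N u" by blast
    then have tk: "t < k" and ku: "k \<le> u" and tu: "t \<noteq> u" and ta: "t \<in> asked k tr c u"
      and th: "c t \<inter> {..<h} \<noteq> {}"
      by (auto simp: asked_def)
    have uO: "u \<in> ?O" using z ku by (auto intro!: hit_exposed simp: asked_def)
    show "z \<in> ?O \<times> ?E \<union> (\<Union>t\<in>?U. ?M t)"
    proof (cases "exposed {..<h} tr t c")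
      case True
      then show ?thesis using uO z(1) tk by auto
    next
      case False
      with tk th have "t \<in> ?U" by simp
      moreover from ta consider "(t, u) \<in> set ?p" | "(u, t) \<in> set ?p" unfolding asked_def by blast
      then have "(u, t) \<in> ?M t"
      proof cases
        case 1
        with tu show ?thesis by (intro image_eqI[of _ _ "(t, u)"]) (auto simp: meets_def partner_def)
      next
        case 2
        with tu show ?thesis by (intro image_eqI[of _ _ "(u, t)"]) (auto simp: meets_def partner_def)
      qed
      ultimately show ?thesis using z(1) by blast
    qed
  qed
  then have "card (SIGMA u : ?H. ?N u) \<le> card (?O \<times> ?E \<union> (\<Union>t\<in>?U. ?M t))"
    by (intro card_mono) auto
  also have "\<dots> \<le> card (?O \<times> ?E) + card (\<Union>t\<in>?U. ?M t)" by (rule card_Un_le)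
  also have "card (\<Union>t\<in>?U. ?M t) \<le> (\<Sum>t\<in>?U. card (?M t))" by (rule card_UN_le) simp
  also have "(\<Sum>t\<in>?U. card (?M t)) \<le> (\<Sum>t\<in>?U. X tr t c)"
  proof (rule sum_mono)
    fix t assume t: "t \<in> ?U"
    have "card (?M t) \<le> card (set (filter (meets t) ?p))" by (rule card_image_le) simp
    also have "\<dots> \<le> degree_in t ?p" unfolding degree_in_def by (rule card_length)
    also have "\<dots> = X tr t c" using t by (intro unexposed_run(2)[of "{..<h}"]) auto
    finally show "card (?M t) \<le> X tr t c" .
  qed
  finally have "card (SIGMA u : ?H. ?N u) \<le> card ?E * card ?O + (\<Sum>t\<in>?U. X tr t c)"
    by (simp add: card_cartesian_product mult.commute)
  then have "near k n h tr c \<le> card ?E * card ?O + (\<Sum>t\<in>?U. X tr t c)"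
    using near_le_card[where k = k and c = c and n = n and h = h and tr = tr] support[OF c]
    by (meson le_trans)
  then have "real (near k n h tr c) \<le> real (card ?E * card ?O + (\<Sum>t\<in>?U. X tr t c))"
    by (rule of_nat_mono)
  also have "\<dots> = real (card ?E) * real (card ?O) + (\<Sum>t\<in>?U. real (X tr t c))" by simp
  also have "(\<Sum>t\<in>?U. real (X tr t c)) = (\<Sum>t\<in>?U. of_bool (c t \<inter> {..<h} \<noteq> {}) * real (X tr t c))"
    by (intro sum.cong) auto
  also have "\<dots> \<le> unexposed_weight h tr c"
    unfolding unexposed_weight_def by (intro sum_mono2) auto
  finally show ?thesis unfolding exposed_terminals_def exposed_others_def by simp
qed

end

section \<open>The two distributions\<close>

lemma prob_bernoulli_bind:
  assumes p: "0 \<le> p" "p \<le> 1" and fin: "\<And>b. finite (set_pmf (F b))"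
  shows "measure_pmf.prob (bernoulli_pmf p \<bind> F) S =
    p * measure_pmf.prob (F True) S + (1 - p) * measure_pmf.prob (F False) S"
proof -
  have "measure_pmf.expectation (bernoulli_pmf p \<bind> F) (indicator S :: _ \<Rightarrow> real) =
      (\<Sum>b\<in>UNIV. pmf (bernoulli_pmf p) b *\<^sub>R measure_pmf.expectation (F b) (indicator S))"
    using fin by (intro pmf_expectation_bind) auto
  then show ?thesis using p by (simp add: UNIV_bool)
qed

definition single_label :: "nat set \<Rightarrow> nat set pmf" where
  "single_label A = map_pmf (\<lambda>i. {i}) (pmf_of_set A)"

text \<open>Each label below \<open>h\<close> gets probability \<open>1 / real k\<close>, so one
  terminal is expected to carry it.\<close>

definition terminal_dist :: "nat \<Rightarrow> nat \<Rightarrow> nat \<Rightarrow> nat set pmf" where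
  "terminal_dist k h f = bernoulli_pmf (real h / real k) \<bind>
     (\<lambda>b. single_label (if b then {..<h} else {h..<h + f}))"

text \<open>\<open>tag\<close> will lie outside the terminal labels and so leaves all distances
  unchanged; it lets the analysis recognise hubs.\<close>

definition random_subset :: "nat \<Rightarrow> nat \<Rightarrow> real \<Rightarrow> nat set pmf" where
  "random_subset h tag p =
     map_pmf (\<lambda>b. insert tag {i. i < h \<and> b i}) (Pi_pmf {..<h} False (\<lambda>_. bernoulli_pmf p))"

text \<open>
  A non-terminal is a hub, marked by \<open>tag\<close>, with probability \<open>\<rho>\<close>. The probability \<open>\<rho> * (s - 1)\<close> of
  the empty set makes every label as likely as under \<open>single_label {..<h}\<close>.
\<close>

definition hub_dist :: "nat \<Rightarrow> nat \<Rightarrow> real \<Rightarrow> real \<Rightarrow> nat set pmf" where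
  "hub_dist h tag \<rho> s = bernoulli_pmf (\<rho> * s) \<bind> (\<lambda>z. if z
     then bernoulli_pmf (1 / s) \<bind> (\<lambda>y. if y then random_subset h tag (s / real h) else return_pmf {})
     else single_label {..<h})"

lemma set_single_label: "finite A \<Longrightarrow> A \<noteq> {} \<Longrightarrow> set_pmf (single_label A) = (\<lambda>i. {i}) ` A"
  unfolding single_label_def by simp

lemma prob_single_label:
  assumes "finite A" "A \<noteq> {}"
  shows "measure_pmf.prob (single_label A) {L. j \<in> L} = (if j \<in> A then 1 / real (card A) else 0)"
proof -
  have "measure_pmf.prob (single_label A) {L. j \<in> L} = measure_pmf.prob (pmf_of_set A) {i. i = j}"
    unfolding single_label_def by (simp add: vimage_def eq_commute)
  also have "\<dots> = (if j \<in> A then 1 / real (card A) else 0)"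
    using measure_pmf_of_set[OF assms(2,1), of "{i. i = j}"] by auto
  finally show ?thesis .
qed

lemma finite_random_subset: "finite (set_pmf (random_subset h tag p))"
  unfolding random_subset_def set_map_pmf
  by (intro finite_imageI finite_set_Pi_pmf) (auto intro: finite_subset[OF subset_UNIV])

lemma prob_random_subset:
  assumes p: "0 \<le> p" "p \<le> 1" and I: "I \<subseteq> {..<h}" and tag: "h \<le> tag"
  shows "measure_pmf.prob (random_subset h tag p) {L. I \<subseteq> L} = p ^ card I"
proof -
  have "measure_pmf.prob (random_subset h tag p) {L. I \<subseteq> L} =
      measure_pmf.prob (Pi_pmf {..<h} False (\<lambda>_. bernoulli_pmf p))
        (Pi {..<h} (\<lambda>i. if i \<in> I then {True} else UNIV))"
    unfolding random_subset_def measure_map_pmf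
    by (intro arg_cong[of _ _ "measure_pmf.prob _"]) (use I tag in \<open>auto simp: Pi_def split: if_splits\<close>)
  also have "\<dots> = (\<Prod>i<h. measure_pmf.prob (bernoulli_pmf p) (if i \<in> I then {True} else UNIV))"
    by (simp add: measure_Pi_pmf_Pi)
  also have "\<dots> = (\<Prod>i<h. if i \<in> I then p else 1)"
    using p by (intro prod.cong) (auto simp: measure_pmf_single)
  also have "\<dots> = p ^ card I"
    using I by (simp add: prod.If_cases Int_absorb1)
  finally show ?thesis .
qed

lemma random_subset_labels:
  "L \<in> set_pmf (random_subset h tag p) \<Longrightarrow> tag \<in> L \<and> L \<subseteq> insert tag {..<h}"
  unfolding random_subset_def by auto

text \<open>\<open>s\<close> is the expected number of labels below \<open>h\<close> at a hub, and
  \<open>\<rho>\<close> the density of hubs. The bounds make \<open>s / real h\<close> and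
  \<open>\<rho> * s\<close> probabilities.\<close>

locale hard_instance =
  fixes k n h f :: nat and \<rho> s :: real
  assumes f2: "2 \<le> f" and fh: "f \<le> h" and hk: "h \<le> k" and kn: "k < n"
    and s1: "1 \<le> s" and sh: "s \<le> real h" and \<rho>0: "0 \<le> \<rho>" and \<rho>s: "\<rho> * s \<le> 1"
begin

abbreviation tag :: nat where "tag \<equiv> h + f"

definition no_dist :: "nat \<Rightarrow> nat set pmf" where
  "no_dist x = (if x < k then terminal_dist k h f else single_label {..<h})"

definition yes_dist :: "nat \<Rightarrow> nat set pmf" where
  "yes_dist x = (if x < k then terminal_dist k h f else hub_dist h tag \<rho> s)"

abbreviation "NO \<equiv> Pi_pmf {..<n} {} no_dist"
abbreviation "YES \<equiv> Pi_pmf {..<n} {} yes_dist"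

lemma pos: "0 < h" "0 < k" "0 < f" "0 < n"
  using f2 fh hk kn by auto

lemma finite_single: "finite (set_pmf (single_label {..<h}))" "finite (set_pmf (single_label {h..<h + f}))"
  using pos by (auto simp: set_single_label lessThan_empty_iff)

lemma finite_terminal: "finite (set_pmf (terminal_dist k h f))"
  unfolding terminal_dist_def set_bind_pmf
  by (intro finite_UN_I) (auto intro: finite_subset[OF subset_UNIV] simp: finite_single)

lemma terminal_support:
  assumes "L \<in> set_pmf (terminal_dist k h f)"
  shows "\<exists>i<h + f. L = {i}"
  using assms pos unfolding terminal_dist_def
  by (auto simp: set_single_label lessThan_empty_iff split: if_splits)

lemma prob_terminal:
  "measure_pmf.prob (terminal_dist k h f) {L. j \<in> L} =
     (if j < h then 1 / real k else if j < h + f then (1 - real h / real k) / real f else 0)"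
proof -
  have "measure_pmf.prob (terminal_dist k h f) {L. j \<in> L} =
      real h / real k * measure_pmf.prob (single_label {..<h}) {L. j \<in> L} +
      (1 - real h / real k) * measure_pmf.prob (single_label {h..<h + f}) {L. j \<in> L}"
    unfolding terminal_dist_def using pos hk finite_single by (subst prob_bernoulli_bind) auto
  then show ?thesis using pos by (simp add: prob_single_label lessThan_empty_iff)
qed

lemma prob_terminal_low: "measure_pmf.prob (terminal_dist k h f) {L. L \<inter> {..<h} \<noteq> {}} \<le> real h / real k"
  using prob_Int_le_card[of "{..<h}" "terminal_dist k h f" "1 / real k"] by (simp add: prob_terminal)

lemma prob_hub:
  "measure_pmf.prob (hub_dist h tag \<rho> s) S =
     \<rho> * measure_pmf.prob (random_subset h tag (s / real h)) S + \<rho> * (s - 1) * indicator S {}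
     + (1 - \<rho> * s) * measure_pmf.prob (single_label {..<h}) S"
proof -
  let ?F = "\<lambda>y. if y then random_subset h tag (s / real h) else return_pmf {}"
  have finF: "finite (set_pmf (?F y))" for y by (simp add: finite_random_subset)
  have fin1: "finite (set_pmf (bernoulli_pmf (1 / s) \<bind> ?F))"
    unfolding set_bind_pmf using finF by (intro finite_UN_I) (auto intro: finite_subset[OF subset_UNIV])
  have "measure_pmf.prob (hub_dist h tag \<rho> s) S =
      \<rho> * s * measure_pmf.prob (bernoulli_pmf (1 / s) \<bind> ?F) S
      + (1 - \<rho> * s) * measure_pmf.prob (single_label {..<h}) S"
    unfolding hub_dist_def using \<rho>0 s1 \<rho>s fin1 finite_single by (subst prob_bernoulli_bind) auto
  also have "measure_pmf.prob (bernoulli_pmf (1 / s) \<bind> ?F) S =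
      1 / s * measure_pmf.prob (random_subset h tag (s / real h)) S + (1 - 1 / s) * indicator S {}"
    using s1 finF by (subst prob_bernoulli_bind) (auto simp: measure_return_pmf)
  also have "\<rho> * s * (1 / s * a + (1 - 1 / s) * b) = \<rho> * a + \<rho> * (s - 1) * b" for a b
    using s1 by (simp add: field_simps)
  finally show ?thesis .
qed

lemma finite_hub: "finite (set_pmf (hub_dist h tag \<rho> s))"
  unfolding hub_dist_def set_bind_pmf
  by (intro finite_UN_I)
    (auto intro: finite_subset[OF subset_UNIV] simp: finite_single finite_random_subset set_bind_pmf)

lemma p_bounds: "0 \<le> s / real h" "s / real h \<le> 1"
  using s1 sh pos by auto

text \<open>The calibration of the two distributions: hubs contribute \<open>\<rho> * s / h\<close>
  and single labels \<open>(1 - \<rho> * s) / h\<close>.\<close>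

lemma prob_hub_label:
  assumes "i < h"
  shows "measure_pmf.prob (hub_dist h tag \<rho> s) {L. i \<in> L} = 1 / real h"
proof -
  have "measure_pmf.prob (random_subset h tag (s / real h)) {L. i \<in> L} = s / real h"
    using prob_random_subset[OF p_bounds, of "{i}" h tag] assms by simp
  moreover have "measure_pmf.prob (single_label {..<h}) {L. i \<in> L} = 1 / real h"
    using assms pos by (simp add: prob_single_label lessThan_empty_iff)
  ultimately have "measure_pmf.prob (hub_dist h tag \<rho> s) {L. i \<in> L} =
      \<rho> * (s / real h) + (1 - \<rho> * s) * (1 / real h)"
    unfolding prob_hub by simp
  then show ?thesis by (simp add: field_simps add_divide_distrib[symmetric])
qed

lemma single_label_pair:
  assumes "i \<noteq> j"
  shows "measure_pmf.prob (single_label {..<h}) {L. i \<in> L \<and> j \<in> L} = 0"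
  using assms pos by (auto simp: measure_pmf_zero_iff set_single_label lessThan_empty_iff)

text \<open>Only a hub can carry two labels below \<open>h\<close>, and it carries two given ones
  with probability \<open>(s / h)\<^sup>2\<close>.\<close>

lemma prob_hub_pair:
  assumes "i < h" "j < h" "i \<noteq> j"
  shows "measure_pmf.prob (hub_dist h tag \<rho> s) {L. i \<in> L \<and> j \<in> L} \<le> \<rho> * s\<^sup>2 / real h / real h"
proof -
  have "{i, j} \<subseteq> {..<h}" using assms by auto
  from prob_random_subset[OF p_bounds this, of tag]
  have "measure_pmf.prob (random_subset h tag (s / real h)) {L. i \<in> L \<and> j \<in> L} = (s / real h)\<^sup>2"
    using assms by (simp add: power2_eq_square)
  then show ?thesis unfolding prob_hub
    using single_label_pair[OF assms(3)] by (simp add: power2_eq_square)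
qed

lemma prob_hub_null:
  assumes "h \<le> i" "i \<noteq> tag"
  shows "measure_pmf.prob (hub_dist h tag \<rho> s) {L. i \<in> L} = 0"
proof -
  have "measure_pmf.prob (random_subset h tag (s / real h)) {L. i \<in> L} = 0"
    using assms random_subset_labels by (fastforce simp: measure_pmf_zero_iff)
  moreover have "measure_pmf.prob (single_label {..<h}) {L. i \<in> L} = 0"
    using assms pos by (simp add: prob_single_label lessThan_empty_iff)
  ultimately show ?thesis unfolding prob_hub by simp
qed

lemma prob_random_subset_tag:
  "measure_pmf.prob (random_subset h tag p) {L. tag \<in> L \<and> R L} = measure_pmf.prob (random_subset h tag p) {L. R L}"
  using random_subset_labels by (intro measure_pmf.finite_measure_eq_AE) (auto simp: AE_measure_pmf_iff)

lemma single_label_tag: "measure_pmf.prob (single_label {..<h}) {L. tag \<in> L \<and> R L} = 0"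
  using pos by (auto simp: measure_pmf_zero_iff set_single_label lessThan_empty_iff)

lemma prob_hub_tag: "measure_pmf.prob (hub_dist h tag \<rho> s) {L. tag \<in> L} = \<rho>"
  using prob_random_subset_tag[of "s / real h" "\<lambda>_. True"] single_label_tag[of "\<lambda>_. True"]
  unfolding prob_hub by simp

lemma prob_hub_tag_label:
  assumes "i < h"
  shows "measure_pmf.prob (hub_dist h tag \<rho> s) {L. tag \<in> L \<and> i \<in> L} = \<rho> * s / real h"
  using prob_random_subset_tag[of "s / real h" "\<lambda>L. i \<in> L"] single_label_tag[of "\<lambda>L. i \<in> L"]
    prob_random_subset[OF p_bounds, of "{i}" h tag] assms
  unfolding prob_hub by simp

sublocale random_labels "{..<n}" k f no_dist
proof
  fix v j
  \<comment> \<open>No label is more likely than \<open>1 / real f\<close>, since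
    \<open>f \<le> h\<close> and \<open>h \<le> k\<close>.\<close>
  have "(1 - real h / real k) / real f \<le> 1 / real f" by (intro divide_right_mono) auto
  moreover have "1 / real k \<le> 1 / real f" "1 / real h \<le> 1 / real f"
    using pos fh hk by (auto intro!: divide_left_mono)
  ultimately show "measure_pmf.prob (no_dist v) {L. j \<in> L} \<le> 1 / real f"
    using pos by (auto simp: no_dist_def prob_terminal prob_single_label lessThan_empty_iff)
next
  fix v L assume "L \<in> set_pmf (no_dist v)"
  then show "finite L \<and> card L \<le> 1"
    using terminal_support[of L] pos
    by (auto simp: no_dist_def set_single_label lessThan_empty_iff split: if_splits)
qed (auto simp: f2 no_dist_def finite_terminal finite_single)

lemma no_support:
  assumes "c \<in> set_pmf NO"
  shows "t < k \<Longrightarrow> \<exists>i<h + f. c t = {i}" and "u \<in> {k..<n} \<Longrightarrow> \<exists>i<h. c u = {i}"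
proof -
  have c: "c x \<in> set_pmf (no_dist x)" if "x < n" for x
    using assms that by (auto simp: set_Pi_pmf PiE_dflt_def)
  show "t < k \<Longrightarrow> \<exists>i<h + f. c t = {i}"
    using c[of t] kn terminal_support unfolding no_dist_def by auto
  show "u \<in> {k..<n} \<Longrightarrow> \<exists>i<h. c u = {i}"
    using c[of u] pos by (auto simp: no_dist_def set_single_label lessThan_empty_iff)
qed

lemma finite_YES: "finite (set_pmf YES)"
  by (intro finite_set_Pi_pmf) (auto simp: yes_dist_def finite_terminal finite_hub)

lemma yes_support:
  assumes "c \<in> set_pmf YES" "t < k"
  shows "\<exists>i<h + f. c t = {i}"
proof -
  have "c t \<in> set_pmf (yes_dist t)"
    using assms kn by (auto simp: set_Pi_pmf PiE_dflt_def)
  then show ?thesis using assms(2) terminal_support unfolding yes_dist_def by auto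
qed

text \<open>Bounds the YES probability that a non-terminal with a given label below \<open>h\<close>
  carries another given one as well.\<close>

definition \<kappa> :: real where "\<kappa> = \<rho> * s\<^sup>2 / real h"

lemma prob_NO_indist_le:
  assumes c: "c \<in> set_pmf NO" and near: "\<kappa> * real (near k n h tr c) \<le> 1 / 2"
  shows "measure_pmf.prob NO (indist k n tr c) \<le> 2 * measure_pmf.prob YES (indist k n tr c)"
proof (rule prob_indist_compare[where \<kappa> = \<kappa> and h = h])
  show "k \<le> n" using kn by simp
  show \<kappa>0: "0 \<le> \<kappa>" unfolding \<kappa>_def using \<rho>0 by simp
  show "yes_dist t = no_dist t" if "t < k" for t using that unfolding yes_dist_def no_dist_def by simp
  show "\<kappa> * real (near k n h tr c) \<le> 1 / 2" by (rule near)
  fix u assume u: "u \<in> {k..<n}"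
  obtain g where g: "g < h" "c u = {g}" using no_support(2)[OF c u] by blast
  define Q where "Q = asked_labels k tr c u"
  have T: "finite (c t) \<and> c t \<subseteq> {..<h + f}" if "t < k" for t
    using no_support(1)[OF c that] by auto
  \<comment> \<open>Asked labels are terminal labels, hence never the tag, the only label from
    \<open>h\<close> on that a hub can carry.\<close>
  have Q: "finite Q" "Q \<subseteq> {..<h + f}"
    unfolding Q_def asked_labels_def using T by (auto simp: asked_def)
  have "(1 - \<kappa> * real (if {g} \<inter> Q = {} then 0 else card (Q \<inter> {..<h})))
      * measure_pmf.prob (map_pmf (\<lambda>i. {i}) (pmf_of_set {..<h})) {L. L \<inter> Q = {g} \<inter> Q}
      \<le> measure_pmf.prob (hub_dist h tag \<rho> s) {L. L \<inter> Q = {g} \<inter> Q}"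
  proof (rule prob_inter_ge_single_label[OF pos(1) Q(1) g(1)])
    show "measure_pmf.prob (hub_dist h tag \<rho> s) {L. i \<in> L} = 0" if "i \<in> Q" "h \<le> i" for i
      using that Q(2) by (intro prob_hub_null) auto
    show "measure_pmf.prob (hub_dist h tag \<rho> s) {L. i \<in> L \<and> j \<in> L} \<le> \<kappa> / real h"
      if "i < h" "j < h" "i \<noteq> j" for i j
      unfolding \<kappa>_def by (rule prob_hub_pair[OF that])
  qed (auto simp: prob_hub_label \<kappa>0)
  moreover have "no_dist u = map_pmf (\<lambda>i. {i}) (pmf_of_set {..<h})" "yes_dist u = hub_dist h tag \<rho> s"
    using u unfolding no_dist_def yes_dist_def single_label_def by auto
  ultimately show "(1 - \<kappa> * real (if c u \<inter> asked_labels k tr c u = {} then 0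
        else card (asked_labels k tr c u \<inter> {..<h})))
      * measure_pmf.prob (no_dist u) {L. L \<inter> asked_labels k tr c u = c u \<inter> asked_labels k tr c u}
      \<le> measure_pmf.prob (yes_dist u) {L. L \<inter> asked_labels k tr c u = c u \<inter> asked_labels k tr c u}"
    unfolding g Q_def by simp
qed

text \<open>\<open>S\<close> need not be a union of classes. The terminal labels and the output are
  what passes to a whole class, so membership in \<open>S'\<close> has to follow from them.\<close>

lemma prob_NO_le_YES:
  assumes tr: "queries_within {..<n} tr"
    and inv: "\<And>c c'. c \<in> set_pmf NO \<Longrightarrow> c \<in> S \<Longrightarrow> \<forall>t<k. c' t = c t \<Longrightarrow>
       result tr (wt k c') = result tr (wt k c) \<Longrightarrow> c' \<in> S'"
    and near: "\<And>c. c \<in> set_pmf NO \<Longrightarrow> c \<in> S \<Longrightarrow> \<kappa> * real (near k n h tr c) \<le> 1 / 2"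
  shows "measure_pmf.prob NO S \<le> 2 * measure_pmf.prob YES S'"
proof (rule prob_le_by_classes[where cls = "indist k n tr", OF finP])
  fix c assume c: "c \<in> S" "c \<in> set_pmf NO"
  have "indist k n tr c \<subseteq> S'"
  proof
    fix c' assume "c' \<in> indist k n tr c"
    then show "c' \<in> S'" using inv[OF c(2,1)] indist_same_run(2)[OF tr] unfolding indist_def by auto
  qed
  then show "c \<in> indist k n tr c \<and> indist k n tr c \<subseteq> S' \<and>
      measure_pmf.prob NO (indist k n tr c) \<le> 2 * measure_pmf.prob YES (indist k n tr c)"
    using indist_refl prob_NO_indist_le[OF c(2) near[OF c(2,1)]] by blast
qed (rule indist_eq[OF tr])

end

section \<open>Costs and expectations\<close>

lemma prob_component:
  assumes "finite V" "x \<in> V"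
  shows "measure_pmf.prob (Pi_pmf V d D) {c. R (c x)} = measure_pmf.prob (D x) {L. R L}"
proof -
  have "measure_pmf.prob (D x) {L. R L} = measure_pmf.prob (map_pmf (\<lambda>c. c x) (Pi_pmf V d D)) {L. R L}"
    using assms by (simp add: Pi_pmf_component)
  then show ?thesis by (simp add: vimage_def)
qed

lemma prob_all_components:
  assumes "finite V" "U \<subseteq> V" and p: "\<And>x. x \<in> U \<Longrightarrow> measure_pmf.prob (D x) {L. R L} = p"
  shows "measure_pmf.prob (Pi_pmf V d D) {c. \<forall>x\<in>U. R (c x)} = p ^ card U"
proof -
  have "{c. \<forall>x\<in>U. R (c x)} = Pi V (\<lambda>x. if x \<in> U then {L. R L} else UNIV)"
    using assms(2) by (auto simp: Pi_def)
  then have "measure_pmf.prob (Pi_pmf V d D) {c. \<forall>x\<in>U. R (c x)} =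
      (\<Prod>x\<in>V. measure_pmf.prob (D x) (if x \<in> U then {L. R L} else UNIV))"
    using assms(1) by (simp add: measure_Pi_pmf_Pi)
  also have "\<dots> = (\<Prod>x\<in>V. if x \<in> U then p else 1)"
    using p by (intro prod.cong) auto
  also have "\<dots> = p ^ card U"
    using assms(1,2) by (simp add: prod.If_cases Int_absorb1)
  finally show ?thesis .
qed

lemma prob_not: "measure_pmf.prob p {x. \<not> Q x} = 1 - measure_pmf.prob p {x. Q x}"
  using measure_pmf.prob_compl[of "{x. Q x}" p] by (simp add: Compl_eq_Diff_UNIV[symmetric] Collect_neg_eq)

lemma expectation_card:
  assumes "finite (set_pmf p)" "finite I"
  shows "measure_pmf.expectation p (\<lambda>c. real (card {i \<in> I. Q i c})) = (\<Sum>i\<in>I. measure_pmf.prob p {c. Q i c})"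
proof -
  have "(\<lambda>c. real (card {i \<in> I. Q i c})) = (\<lambda>c. \<Sum>i\<in>I. of_bool (Q i c))"
    using assms(2) by (simp add: sum.If_cases Int_def of_bool_def)
  then show ?thesis by (simp add: expectation_sum_pmf[OF assms(1)] expectation_of_bool)
qed

lemma one_minus_power_le_exp:
  fixes x :: real
  assumes "x \<le> 1"
  shows "(1 - x) ^ N \<le> exp (- (x * real N))"
proof -
  have "(1 - x) ^ N \<le> exp (- x) ^ N"
    using assms exp_ge_add_one_self[of "- x"] by (intro power_mono) auto
  also have "\<dots> = exp (- (x * real N))" by (simp add: exp_of_nat_mult[symmetric] mult.commute)
  finally show ?thesis .
qed

section \<open>Steiner costs in the two distributions\<close>

context hard_instance
begin

definition filled :: "(nat \<Rightarrow> nat set) \<Rightarrow> nat" where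
  "filled c = card {i \<in> {..<h}. \<exists>t<k. i \<in> c t}"

definition hubs :: "(nat \<Rightarrow> nat set) \<Rightarrow> nat set" where
  "hubs c = {u \<in> {k..<n}. tag \<in> c u}"

definition uncovered :: "(nat \<Rightarrow> nat set) \<Rightarrow> nat" where
  "uncovered c = card {i \<in> {..<h}. \<forall>u\<in>{k..<n}. \<not> (tag \<in> c u \<and> i \<in> c u)}"

lemma NO_instance:
  assumes "c \<in> set_pmf NO"
  shows "steiner_instance {..<n} {..<k} (wt k c)"
  using no_support(1)[OF assms] pos kn by (intro steiner_instance_wt) auto

lemma YES_instance:
  assumes "c \<in> set_pmf YES"
  shows "steiner_instance {..<n} {..<k} (wt k c)"
  using yes_support[OF assms] pos kn by (intro steiner_instance_wt) auto

text \<open>Every point has exactly one label, so colouring by \<open>c\<close> puts different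
  colours at distance 2; the colour of label \<open>i\<close> is \<open>{i}\<close>.\<close>

lemma ST_NO_ge:
  assumes c: "c \<in> set_pmf NO"
  shows "2 * (real (filled c) - 1) \<le> ST {..<n} {..<k} (wt k c)"
proof -
  have single: "\<exists>i. c x = {i}" if "x < n" for x
    using no_support[OF c, of x] that by (cases "x < k") auto
  have "(\<lambda>i. {i}) ` {i \<in> {..<h}. \<exists>t<k. i \<in> c t} \<subseteq> c ` {..<k}"
    using no_support(1)[OF c] by fastforce
  then have "card ((\<lambda>i. {i}) ` {i \<in> {..<h}. \<exists>t<k. i \<in> c t}) \<le> card (c ` {..<k})"
    by (intro card_mono) auto
  then have "filled c \<le> card (c ` {..<k})"
    unfolding filled_def by (subst (asm) card_image) auto
  then have "2 * (real (filled c) - 1) \<le> 2 * (real (card (c ` {..<k})) - 1)" by simp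
  also have "\<dots> \<le> ST {..<n} {..<k} (wt k c)"
  proof (rule ST_ge_classes[OF NO_instance[OF c]])
    fix x y assume xy: "x \<in> {..<n}" "y \<in> {..<n}" "c x \<noteq> c y"
    then have "c x \<inter> c y = {}" using single[of x] single[of y] by auto
    then show "2 \<le> wt k c x y" using xy unfolding wt_def by auto
  qed
  finally show ?thesis .
qed

text \<open>The tree has the first non-terminal \<open>k\<close> as root. Hubs hang from the root;
  one representative terminal per label hangs from a hub at cost 1, or else from the root at cost at
  most 2; other terminals hang from their representative at cost \<open>1 / real k\<close>, in total
  at most 1.\<close>

lemma ST_hub_tree_le:
  assumes single: "\<And>t. t < k \<Longrightarrow> \<exists>i<h + f. c t = {i}"
  shows "ST {..<n} {..<k} (wt k c) \<le>
    real (filled c) + real (uncovered c) + 2 * real f + 2 * real (card (hubs c)) + 1"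
proof -
  define lab where "lab t = the_elem (c t)" for t
  have lab: "c t = {lab t}" "lab t < h + f" if t: "t < k" for t
  proof -
    obtain i where "i < h + f" "c t = {i}" using single[OF t] by blast
    then show "c t = {lab t}" "lab t < h + f" unfolding lab_def by simp_all
  qed
  \<comment> \<open>The least terminal depends only on the label, so representatives are fixed
    points of \<open>rep\<close>.\<close>
  define rep where "rep t = (LEAST t'. t' < k \<and> lab t' = lab t)" for t
  have rep: "rep t < k" "lab (rep t) = lab t" "rep t \<le> t" if "t < k" for t
    unfolding rep_def
    using LeastI[of "\<lambda>t'. t' < k \<and> lab t' = lab t" t] that
      Least_le[of "\<lambda>t'. t' < k \<and> lab t' = lab t" t] by simp_all
  have reprep: "rep (rep t) = rep t" if "t < k" for t
    using rep(2)[OF that] unfolding rep_def by simp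
  define covered where "covered i \<longleftrightarrow> (\<exists>u\<in>hubs c. i \<in> c u)" for i
  define hub where "hub i = (SOME u. u \<in> hubs c \<and> i \<in> c u)" for i
  have hub: "hub i \<in> hubs c" "i \<in> c (hub i)" if "covered i" for i
    using someI_ex[of "\<lambda>u. u \<in> hubs c \<and> i \<in> c u"] that unfolding covered_def hub_def by auto
  have hubs: "u \<in> hubs c \<Longrightarrow> k \<le> u \<and> u < n" for u unfolding hubs_def by auto
  have fin: "finite (hubs c)" unfolding hubs_def by simp
  define par where "par v = (if k \<le> v then k else if rep v \<noteq> v then rep v
      else if covered (lab v) then hub (lab v) else k)" for v
  define lev :: "nat \<Rightarrow> nat" where
    "lev v = (if v = k then 0 else if k \<le> v then 1 else if rep v = v then 2 else 3)" for v
  define S where "S = {..<k} \<union> insert k (hubs c)"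
  have finS: "finite S" unfolding S_def using fin by simp
  have "is_tree S (parent_edges S k par)"
  proof (rule is_tree_parent_edges[where lev = lev])
    show "k \<in> S" unfolding S_def by simp
    show "par v \<in> S" if "v \<in> S" "v \<noteq> k" for v
      using that hub(1)[of "lab v"] rep(1)[of v] unfolding S_def par_def by auto
    show "lev (par v) < lev v" if "v \<in> S" "v \<noteq> k" for v
    proof (cases "k \<le> v")
      case True
      then show ?thesis using that unfolding par_def lev_def by simp
    next
      case False
      then show ?thesis
        using rep(1)[of v] reprep[of v] hub(1)[of "lab v"] hubs[of "hub (lab v)"]
        unfolding par_def lev_def by auto
    qed
  qed
  then have "steiner_tree {..<n} {..<k} S (parent_edges S k par)"
    using hubs kn unfolding steiner_tree_def S_def by auto
  then have "ST {..<n} {..<k} (wt k c) \<le> tree_cost (wt k c) (parent_edges S k par)"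
    by (intro ST_le) auto
  also have "\<dots> \<le> (\<Sum>v\<in>S - {k}. wt k c v (par v))"
    by (rule tree_cost_parent_edges_le[OF finS wt_nonneg wt_commute])
  \<comment> \<open>The root may itself be a hub; the larger index set then counts it at a
    nonnegative cost.\<close>
  also have "\<dots> \<le> (\<Sum>v\<in>hubs c \<union> {..<k}. wt k c v (par v))"
    using fin wt_nonneg unfolding S_def by (intro sum_mono2) auto
  also have "\<dots> = (\<Sum>v\<in>hubs c. wt k c v (par v)) + (\<Sum>v<k. wt k c v (par v))"
    using fin hubs by (intro sum.union_disjoint) fastforce+
  also have "(\<Sum>v\<in>hubs c. wt k c v (par v)) \<le> (\<Sum>v\<in>hubs c. 2)" by (intro sum_mono wt_le_2)
  also have "(\<Sum>v<k. wt k c v (par v)) \<le> 1 + (real (filled c) + real (uncovered c) + 2 * real f)"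
  proof -
    \<comment> \<open>Bounds the cost of attaching the representative of label
      \<open>i\<close>.\<close>
    define g :: "nat \<Rightarrow> real" where "g i = (if i < h then 1 + of_bool (\<not> covered i) else 2)" for i
    define Rp where "Rp = {v \<in> {..<k}. rep v = v}"
    have "wt k c v (par v) \<le> 1 / real k + (if v \<in> Rp then g (lab v) else 0)" if "v < k" for v
    proof (cases "rep v = v")
      case False
      then have "wt k c v (par v) \<le> 1 / real k"
        using that rep[OF that] lab[OF that] lab(1)[of "rep v"] unfolding wt_def par_def by auto
      then show ?thesis using False unfolding Rp_def by simp
    next
      case True
      then have R: "v \<in> Rp" using that unfolding Rp_def by simp
      show ?thesis
      proof (cases "lab v < h \<and> covered (lab v)")
        case True
        then have "wt k c v (par v) \<le> 1"
          using that \<open>rep v = v\<close> hub[of "lab v"] hubs[of "hub (lab v)"] lab(1)[OF that]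
          unfolding wt_def par_def by auto
        then show ?thesis using True R by (simp add: g_def add_increasing)
      next
        case False
        then have "g (lab v) = 2" unfolding g_def by auto
        then show ?thesis using wt_le_2[of k c v "par v"] R by (simp add: add_increasing)
      qed
    qed
    then have "(\<Sum>v<k. wt k c v (par v)) \<le> (\<Sum>v<k. 1 / real k + (if v \<in> Rp then g (lab v) else 0))"
      by (intro sum_mono) auto
    also have "\<dots> = 1 + (\<Sum>v\<in>Rp. g (lab v))"
    proof -
      have "{..<k} \<inter> {v. v \<in> Rp} = Rp" unfolding Rp_def by auto
      then show ?thesis using pos by (simp add: sum.distrib sum.If_cases)
    qed
    also have "(\<Sum>v\<in>Rp. g (lab v)) = (\<Sum>i\<in>lab ` Rp. g i)"
    proof (rule sum.reindex_cong[symmetric, where l = lab])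
      show "inj_on lab Rp"
      proof (rule inj_onI)
        fix x y assume "x \<in> Rp" "y \<in> Rp" "lab x = lab y"
        then show "x = y" unfolding Rp_def rep_def by auto
      qed
    qed auto
    also have "\<dots> \<le> (\<Sum>i\<in>{i \<in> {..<h}. \<exists>t<k. i \<in> c t} \<union> {h..<h + f}. g i)"
    proof (rule sum_mono2)
      show "lab ` Rp \<subseteq> {i \<in> {..<h}. \<exists>t<k. i \<in> c t} \<union> {h..<h + f}"
        using lab unfolding Rp_def by fastforce
    qed (auto simp: g_def)
    also have "\<dots> = (\<Sum>i\<in>{i \<in> {..<h}. \<exists>t<k. i \<in> c t}. g i) + (\<Sum>i\<in>{h..<h + f}. g i)"
      by (intro sum.union_disjoint) auto
    also have "(\<Sum>i\<in>{h..<h + f}. g i) = 2 * real f" unfolding g_def by simp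
    also have "(\<Sum>i\<in>{i \<in> {..<h}. \<exists>t<k. i \<in> c t}. g i) =
        real (filled c) + (\<Sum>i\<in>{i \<in> {..<h}. \<exists>t<k. i \<in> c t}. of_bool (\<not> covered i))"
      unfolding g_def filled_def by (simp add: sum.distrib)
    also have "(\<Sum>i\<in>{i \<in> {..<h}. \<exists>t<k. i \<in> c t}. of_bool (\<not> covered i)) \<le>
        (\<Sum>i\<in>{..<h}. (of_bool (\<not> covered i) :: real))"
      by (intro sum_mono2) auto
    also have "\<dots> = real (uncovered c)"
    proof -
      have "{i \<in> {..<h}. \<forall>u\<in>{k..<n}. \<not> (tag \<in> c u \<and> i \<in> c u)} = {i \<in> {..<h}. \<not> covered i}"
        unfolding covered_def hubs_def by auto
      then show ?thesis unfolding uncovered_def by (simp add: of_bool_def sum.If_cases Int_def)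
    qed
    finally show ?thesis by simp
  qed
  finally show ?thesis by simp
qed

text \<open>All terminals miss a given label below \<open>h\<close> with probability
  \<open>(1 - 1 / k) ^ k\<close>, which is at most 1/e.\<close>

lemma E_empty_le: "E (\<lambda>c. real (card {i \<in> {..<h}. \<forall>t\<in>{..<k}. i \<notin> c t})) \<le> real h / 2"
proof -
  have "measure_pmf.prob NO {c. \<forall>t\<in>{..<k}. i \<notin> c t} \<le> 1 / 2" if i: "i < h" for i
  proof -
    have "measure_pmf.prob (no_dist t) {L. i \<notin> L} = 1 - 1 / real k" if "t \<in> {..<k}" for t
      using that i by (simp add: prob_not no_dist_def prob_terminal)
    then have "measure_pmf.prob NO {c. \<forall>t\<in>{..<k}. i \<notin> c t} = (1 - 1 / real k) ^ card {..<k}"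
      using kn by (intro prob_all_components) auto
    also have "\<dots> \<le> exp (- (1 / real k * real k))"
      using pos one_minus_power_le_exp[of "1 / real k" k] by simp
    also have "\<dots> = 1 / exp 1" using pos by (simp add: exp_minus field_simps)
    also have "\<dots> \<le> 1 / 2" using exp_ge_add_one_self[of 1] by (intro divide_left_mono) auto
    finally show ?thesis .
  qed
  then have "(\<Sum>i<h. measure_pmf.prob NO {c. \<forall>t\<in>{..<k}. i \<notin> c t}) \<le> (\<Sum>i<h. 1 / 2)"
    by (intro sum_mono) auto
  then show ?thesis by (subst expectation_card[OF finP]) auto
qed

lemma prob_filled: "measure_pmf.prob NO {c. real (filled c) < real h / 4} \<le> 2 / 3"
proof -
  have "measure_pmf.prob NO {c. real (filled c) < real h / 4} \<le>
      E (\<lambda>c. real (card {i \<in> {..<h}. \<forall>t\<in>{..<k}. i \<notin> c t})) / (3 / 4 * real h)"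
  proof (rule prob_le_expectation[OF finP])
    fix c assume c: "real (filled c) < real h / 4"
    have "filled c + card {i \<in> {..<h}. \<forall>t\<in>{..<k}. i \<notin> c t} =
        card ({i \<in> {..<h}. \<exists>t<k. i \<in> c t} \<union> {i \<in> {..<h}. \<forall>t\<in>{..<k}. i \<notin> c t})"
      unfolding filled_def by (subst card_Un_disjoint) auto
    also have "{i \<in> {..<h}. \<exists>t<k. i \<in> c t} \<union> {i \<in> {..<h}. \<forall>t\<in>{..<k}. i \<notin> c t} = {..<h}" by auto
    finally have "filled c + card {i \<in> {..<h}. \<forall>t\<in>{..<k}. i \<notin> c t} = h"
      by (simp only: card_lessThan)
    then have "real (filled c) + real (card {i \<in> {..<h}. \<forall>t\<in>{..<k}. i \<notin> c t}) = real h"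
      by (simp only: of_nat_add[symmetric])
    then show "3 / 4 * real h \<le> real (card {i \<in> {..<h}. \<forall>t\<in>{..<k}. i \<notin> c t})" using c by linarith
  qed (use pos in auto)
  also have "\<dots> \<le> (real h / 2) / (3 / 4 * real h)"
    using E_empty_le pos by (intro divide_right_mono) auto
  finally show ?thesis using pos by simp
qed

text \<open>Markov's inequality: \<open>\<rho> * (n - k)\<close> hubs are expected, and a label is
  missed by all of them with probability \<open>(1 - \<rho> * s / h) ^ (n - k)\<close>.\<close>

lemma prob_YES_cost:
  assumes a: "0 < a"
  shows "measure_pmf.prob YES {c. a \<le> 2 * real (card (hubs c)) + real (uncovered c)} \<le>
    (2 * \<rho> * real (n - k) + real h * exp (- (\<rho> * s / real h * real (n - k)))) / a"
proof -
  let ?E = "measure_pmf.expectation YES"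
  have "measure_pmf.prob YES {c. a \<le> 2 * real (card (hubs c)) + real (uncovered c)} \<le>
    ?E (\<lambda>c. 2 * real (card (hubs c)) + real (uncovered c)) / a"
    by (rule prob_le_expectation[OF finite_YES _ a]) auto
  also have "?E (\<lambda>c. 2 * real (card (hubs c)) + real (uncovered c)) =
      2 * ?E (\<lambda>c. real (card (hubs c))) + ?E (\<lambda>c. real (uncovered c))"
    by (subst Bochner_Integration.integral_add) (auto intro!: integrable_measure_pmf_finite finite_YES)
  also have "?E (\<lambda>c. real (card (hubs c))) = \<rho> * real (n - k)"
  proof -
    have "measure_pmf.prob YES {c. tag \<in> c u} = \<rho>" if "u \<in> {k..<n}" for u
      using that prob_component[of "{..<n}" u "{}" yes_dist "\<lambda>L. tag \<in> L"]
      by (simp add: yes_dist_def prob_hub_tag)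
    then show ?thesis unfolding hubs_def by (subst expectation_card[OF finite_YES]) auto
  qed
  also have "?E (\<lambda>c. real (uncovered c)) \<le> real h * exp (- (\<rho> * s / real h * real (n - k)))"
  proof -
    have "measure_pmf.prob YES {c. \<forall>u\<in>{k..<n}. \<not> (tag \<in> c u \<and> i \<in> c u)} \<le>
        exp (- (\<rho> * s / real h * real (n - k)))" if i: "i < h" for i
    proof -
      have "measure_pmf.prob (yes_dist u) {L. \<not> (tag \<in> L \<and> i \<in> L)} = 1 - \<rho> * s / real h"
        if "u \<in> {k..<n}" for u
        using that i by (subst prob_not) (simp add: yes_dist_def prob_hub_tag_label)
      then have "measure_pmf.prob YES {c. \<forall>u\<in>{k..<n}. \<not> (tag \<in> c u \<and> i \<in> c u)} =
          (1 - \<rho> * s / real h) ^ card {k..<n}"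
        by (intro prob_all_components) auto
      also have "\<dots> \<le> exp (- (\<rho> * s / real h * real (n - k)))"
        using one_minus_power_le_exp[of "\<rho> * s / real h" "n - k"] \<rho>s pos by (simp add: field_simps)
      finally show ?thesis .
    qed
    then have "(\<Sum>i<h. measure_pmf.prob YES {c. \<forall>u\<in>{k..<n}. \<not> (tag \<in> c u \<and> i \<in> c u)}) \<le>
        (\<Sum>i<h. exp (- (\<rho> * s / real h * real (n - k))))"
      by (intro sum_mono) auto
    then show ?thesis unfolding uncovered_def by (subst expectation_card[OF finite_YES]) auto
  qed
  finally show ?thesis using a by (simp add: divide_right_mono mult.assoc)
qed

lemma inverse_m_le: "1 / real m \<le> 4 / real f"
proof -
  have "f \<le> 4 * m" using f2 unfolding m_def by linarith
  then have "real f \<le> real (4 * m)" by (rule of_nat_mono)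
  then show ?thesis using m_pos pos by (simp add: field_simps)
qed

section \<open>Expected exposure after at most \<open>q\<close> queries\<close>

context
  fixes tr :: query_tree and q :: real
  assumes q: "\<And>c. c \<in> set_pmf NO \<Longrightarrow> real (num_queries tr (wt k c)) \<le> q"
begin

lemma sum_E_X_le_subset:
  assumes "U \<subseteq> {..<n}"
  shows "(\<Sum>v\<in>U. E (\<lambda>c. real (X tr v c))) \<le> 4 * q"
proof -
  have "(\<Sum>v\<in>U. E (\<lambda>c. real (X tr v c))) \<le> (\<Sum>v\<in>{..<n}. E (\<lambda>c. real (X tr v c)))"
    using assms by (intro sum_mono2) (auto intro: integral_nonneg_AE)
  also have "\<dots> \<le> 4 * q" using sum_E_X_le[OF q] .
  finally show ?thesis .
qed

text \<open>\<open>prob_exposed_le\<close> with \<open>\<alpha> = 1 / k\<close> and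
  \<open>\<beta> = h / k\<close>, as labels below \<open>h\<close> are rare at terminals.\<close>

lemma E_exposed_terminals_le:
  "E (\<lambda>c. real (exposed_terminals h tr c)) \<le> (1 / real k + real h / real k * (4 / real f)) * (4 * q)"
proof -
  let ?\<theta> = "1 / real k + real h / real k / real m"
  have "E (\<lambda>c. real (exposed_terminals h tr c)) = (\<Sum>t<k. E (\<lambda>c. of_bool (exposed {..<h} tr t c)))"
    unfolding exposed_terminals_def expectation_of_bool by (intro expectation_card[OF finP]) simp
  also have "\<dots> \<le> (\<Sum>t<k. ?\<theta> * E (\<lambda>c. real (X tr t c)))"
  proof (rule sum_mono)
    fix t assume t: "t \<in> {..<k}"
    show "E (\<lambda>c. of_bool (exposed {..<h} tr t c)) \<le> ?\<theta> * E (\<lambda>c. real (X tr t c))"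
      using t kn prob_terminal_low by (intro prob_exposed_le) (auto simp: no_dist_def prob_terminal)
  qed
  also have "\<dots> = ?\<theta> * (\<Sum>t<k. E (\<lambda>c. real (X tr t c)))" by (simp add: sum_distrib_left)
  also have "\<dots> \<le> ?\<theta> * (4 * q)"
    using kn by (intro mult_left_mono sum_E_X_le_subset) auto
  also have "\<dots> \<le> (1 / real k + real h / real k * (4 / real f)) * (4 * q)"
  proof (intro mult_right_mono add_left_mono)
    show "real h / real k / real m \<le> real h / real k * (4 / real f)"
      using mult_left_mono[OF inverse_m_le, of "real h / real k"] by simp
    \<comment> \<open>That \<open>q\<close> is nonnegative is read off from the bound
      itself.\<close>
    have "0 \<le> (\<Sum>v\<in>{..<n}. E (\<lambda>c. real (X tr v c)))" by (auto intro!: sum_nonneg integral_nonneg_AE)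
    then show "0 \<le> 4 * q" using sum_E_X_le_subset[of "{..<n}"] by simp
  qed
  finally show ?thesis .
qed

text \<open>Non-terminals always have a label, so \<open>\<beta> = 1\<close>; the 5 is 1 for hits
  plus 4 from \<open>inverse_m_le\<close>.\<close>

lemma E_exposed_others_le:
  "E (\<lambda>c. real (exposed_others n tr c)) \<le> 5 / real f * (4 * q)"
proof -
  let ?\<theta> = "1 / real f + 1 / real m"
  have "E (\<lambda>c. real (exposed_others n tr c)) = (\<Sum>u\<in>{k..<n}. E (\<lambda>c. of_bool (exposed UNIV tr u c)))"
    unfolding exposed_others_def expectation_of_bool by (intro expectation_card[OF finP]) simp
  also have "\<dots> \<le> (\<Sum>u\<in>{k..<n}. ?\<theta> * E (\<lambda>c. real (X tr u c)))"
  proof (rule sum_mono)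
    fix u assume u: "u \<in> {k..<n}"
    show "E (\<lambda>c. of_bool (exposed UNIV tr u c)) \<le> ?\<theta> * E (\<lambda>c. real (X tr u c))"
      using u spread by (intro prob_exposed_le) auto
  qed
  also have "\<dots> = ?\<theta> * (\<Sum>u\<in>{k..<n}. E (\<lambda>c. real (X tr u c)))" by (simp add: sum_distrib_left)
  also have "\<dots> \<le> ?\<theta> * (4 * q)"
    by (intro mult_left_mono sum_E_X_le_subset) auto
  also have "\<dots> \<le> 5 / real f * (4 * q)"
  proof (intro mult_right_mono)
    show "1 / real f + 1 / real m \<le> 5 / real f" using inverse_m_le by (simp add: field_simps)
    have "0 \<le> (\<Sum>v\<in>{..<n}. E (\<lambda>c. real (X tr v c)))" by (auto intro!: sum_nonneg integral_nonneg_AE)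
    then show "0 \<le> 4 * q" using sum_E_X_le_subset[of "{..<n}"] by simp
  qed
  finally show ?thesis .
qed

lemma E_unexposed_weight_le:
  "E (unexposed_weight h tr) \<le> real h / real k * (4 * q)"
proof -
  have "E (unexposed_weight h tr) = (\<Sum>t<k. E (\<lambda>c. of_bool (c t \<inter> {..<h} \<noteq> {}) * real (X tr t c)))"
    unfolding unexposed_weight_def by (rule expectation_sum_pmf[OF finP])
  also have "\<dots> \<le> (\<Sum>t<k. real h / real k * E (\<lambda>c. real (X tr t c)))"
  proof (rule sum_mono)
    fix t assume t: "t \<in> {..<k}"
    show "E (\<lambda>c. of_bool (c t \<inter> {..<h} \<noteq> {}) * real (X tr t c)) \<le> real h / real k * E (\<lambda>c. real (X tr t c))"
    proof (subst E_labelled_X, goal_cases)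
      case 2
      have "measure_pmf.prob (no_dist t) {L. L \<inter> {..<h} \<noteq> {}} \<le> real h / real k"
        using t prob_terminal_low by (simp add: no_dist_def)
      then show ?case by (intro mult_right_mono integral_nonneg_AE) auto
    qed (use t kn in simp)
  qed
  also have "\<dots> = real h / real k * (\<Sum>t<k. E (\<lambda>c. real (X tr t c)))" by (simp add: sum_distrib_left)
  also have "\<dots> \<le> real h / real k * (4 * q)"
    using kn by (intro mult_left_mono sum_E_X_le_subset) auto
  finally show ?thesis .
qed

text \<open>By \<open>near_le_exposed\<close> one of three quantities reaches its threshold;
  Markov's inequality handles each.\<close>

lemma prob_near:
  assumes ab: "0 < a" "0 < b" "0 < d"
  shows "measure_pmf.prob NO {c. a * b + d \<le> real (near k n h tr c)} \<le>
    (1 / real k + real h / real k * (4 / real f)) * (4 * q) / a + 5 / real f * (4 * q) / b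
    + real h / real k * (4 * q) / d"
proof -
  let ?A = "{c. a \<le> real (exposed_terminals h tr c)}"
  let ?B = "{c. b \<le> real (exposed_others n tr c)}"
  let ?D = "{c. d \<le> unexposed_weight h tr c}"
  have nnD: "0 \<le> unexposed_weight h tr c" for c unfolding unexposed_weight_def by (intro sum_nonneg) auto
  have "measure_pmf.prob NO {c. a * b + d \<le> real (near k n h tr c)} =
      measure_pmf.prob NO ({c. a * b + d \<le> real (near k n h tr c)} \<inter> set_pmf NO)"
    by (simp add: measure_Int_set_pmf)
  also have "\<dots> \<le> measure_pmf.prob NO (?A \<union> ?B \<union> ?D)"
  proof (intro measure_pmf.finite_measure_mono subsetI)
    fix c assume c: "c \<in> {c. a * b + d \<le> real (near k n h tr c)} \<inter> set_pmf NO"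
    show "c \<in> ?A \<union> ?B \<union> ?D"
    proof (rule ccontr)
      assume "c \<notin> ?A \<union> ?B \<union> ?D"
      then have l: "real (exposed_terminals h tr c) < a" "real (exposed_others n tr c) < b"
        "unexposed_weight h tr c < d" by auto
      then have "real (exposed_terminals h tr c) * real (exposed_others n tr c) \<le> a * b"
        by (intro mult_mono) auto
      then show False using near_le_exposed[of c n h tr] c l(3) by auto
    qed
  qed auto
  also have "\<dots> \<le> measure_pmf.prob NO (?A \<union> ?B) + measure_pmf.prob NO ?D" by (intro measure_Un_le) auto
  also have "measure_pmf.prob NO (?A \<union> ?B) \<le> measure_pmf.prob NO ?A + measure_pmf.prob NO ?B"
    by (intro measure_Un_le) auto
  also have "measure_pmf.prob NO ?A \<le> E (\<lambda>c. real (exposed_terminals h tr c)) / a"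
    by (rule prob_le_expectation[OF finP _ ab(1)]) auto
  also have "\<dots> \<le> (1 / real k + real h / real k * (4 / real f)) * (4 * q) / a"
    using ab E_exposed_terminals_le by (intro divide_right_mono) auto
  also have "measure_pmf.prob NO ?B \<le> E (\<lambda>c. real (exposed_others n tr c)) / b"
    by (rule prob_le_expectation[OF finP _ ab(2)]) auto
  also have "\<dots> \<le> 5 / real f * (4 * q) / b"
    using ab E_exposed_others_le by (intro divide_right_mono) auto
  also have "measure_pmf.prob NO ?D \<le> E (unexposed_weight h tr) / d"
    by (rule prob_le_expectation[OF finP nnD ab(3)]) auto
  also have "\<dots> \<le> real h / real k * (4 * q) / d"
    using ab E_unexposed_weight_le by (intro divide_right_mono) auto
  finally show ?thesis by simp
qed

end

end

section \<open>Averaging over the coins\<close>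

definition accurate :: "nat \<Rightarrow> nat \<Rightarrow> real \<Rightarrow> (nat \<Rightarrow> nat set) \<Rightarrow> query_tree \<Rightarrow> bool" where
  "accurate k n \<alpha> c tr \<longleftrightarrow> ST {..<n} {..<k} (wt k c) \<le> result tr (wt k c) \<and>
     result tr (wt k c) \<le> \<alpha> * ST {..<n} {..<k} (wt k c)"

context hard_instance
begin

text \<open>For fixed coins, an accurate output on a NO labelling is at least
  \<open>2 * (filled c - 1)\<close>. On an indistinguishable YES labelling it exceeds
  \<open>2 - \<epsilon>\<close> times the cost, unless hubs and uncovered labels are unusually many.
  The constants leave 1 - 2/3 - 1/24 - 2/24 = 5/24.\<close>

lemma inaccurate_on_average:
  fixes \<epsilon> :: real
  assumes \<epsilon>: "0 < \<epsilon>" "\<epsilon> < 1" and tr: "queries_within {..<n} tr"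
    and near: "measure_pmf.prob NO {c. \<not> \<kappa> * real (near k n h tr c) \<le> 1 / 2} \<le> 1 / 24"
    and cost: "measure_pmf.prob YES {c. \<epsilon> * real h / 16 \<le> 2 * real (card (hubs c)) + real (uncovered c)} \<le> 1 / 24"
    and f: "real f \<le> \<epsilon> * real h / 64" and h: "128 \<le> \<epsilon> * real h"
  shows "1 / 5 \<le> measure_pmf.prob NO {c. \<not> accurate k n (2 - \<epsilon>) c tr}
    + 2 * measure_pmf.prob YES {c. \<not> accurate k n (2 - \<epsilon>) c tr}"
proof -
  define S where "S = {c. real h / 4 \<le> real (filled c) \<and> accurate k n (2 - \<epsilon>) c tr
     \<and> \<kappa> * real (near k n h tr c) \<le> 1 / 2}"
  define S' where "S' = {c. real h / 4 \<le> real (filled c) \<and> 2 * (real (filled c) - 1) \<le> result tr (wt k c)}"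
  have "1 = measure_pmf.prob NO (S \<union> - S)" by simp
  also have "- S = {c. real (filled c) < real h / 4} \<union> {c. \<not> accurate k n (2 - \<epsilon>) c tr}
      \<union> {c. \<not> \<kappa> * real (near k n h tr c) \<le> 1 / 2}"
    unfolding S_def by auto
  also have "measure_pmf.prob NO (S \<union> ({c. real (filled c) < real h / 4} \<union> {c. \<not> accurate k n (2 - \<epsilon>) c tr}
      \<union> {c. \<not> \<kappa> * real (near k n h tr c) \<le> 1 / 2})) \<le> measure_pmf.prob NO S
      + (measure_pmf.prob NO {c. real (filled c) < real h / 4} + measure_pmf.prob NO {c. \<not> accurate k n (2 - \<epsilon>) c tr}
      + measure_pmf.prob NO {c. \<not> \<kappa> * real (near k n h tr c) \<le> 1 / 2})"
    by (intro order_trans[OF measure_Un_le] add_left_mono add_right_mono) auto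
  finally have lo: "1 - 2 / 3 - 1 / 24 - measure_pmf.prob NO {c. \<not> accurate k n (2 - \<epsilon>) c tr}
      \<le> measure_pmf.prob NO S"
    using prob_filled near by linarith
  have "measure_pmf.prob NO S \<le> 2 * measure_pmf.prob YES S'"
  proof (rule prob_NO_le_YES[OF tr])
    fix c c' assume c: "c \<in> set_pmf NO" "c \<in> S" and T: "\<forall>t<k. c' t = c t"
      and r: "result tr (wt k c') = result tr (wt k c)"
    have "filled c' = filled c"
      unfolding filled_def using T by (intro arg_cong[of _ _ card]) auto
    then show "c' \<in> S'" using c(2) r ST_NO_ge[OF c(1)] unfolding S_def S'_def accurate_def by auto
  qed (simp add: S_def)
  also have "measure_pmf.prob YES S' \<le> measure_pmf.prob YES ({c. \<not> accurate k n (2 - \<epsilon>) c tr}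
      \<union> {c. \<epsilon> * real h / 16 \<le> 2 * real (card (hubs c)) + real (uncovered c)})"
  proof -
    have "measure_pmf.prob YES S' = measure_pmf.prob YES (S' \<inter> set_pmf YES)"
      by (simp add: measure_Int_set_pmf)
    also have "\<dots> \<le> measure_pmf.prob YES ({c. \<not> accurate k n (2 - \<epsilon>) c tr}
      \<union> {c. \<epsilon> * real h / 16 \<le> 2 * real (card (hubs c)) + real (uncovered c)})"
    proof (intro measure_pmf.finite_measure_mono subsetI)
      fix c assume c: "c \<in> S' \<inter> set_pmf YES"
      show "c \<in> {c. \<not> accurate k n (2 - \<epsilon>) c tr}
        \<union> {c. \<epsilon> * real h / 16 \<le> 2 * real (card (hubs c)) + real (uncovered c)}"
      proof (rule ccontr)
        assume "c \<notin> {c. \<not> accurate k n (2 - \<epsilon>) c tr}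
          \<union> {c. \<epsilon> * real h / 16 \<le> 2 * real (card (hubs c)) + real (uncovered c)}"
        then have a: "result tr (wt k c) \<le> (2 - \<epsilon>) * ST {..<n} {..<k} (wt k c)"
          and x: "2 * real (card (hubs c)) + real (uncovered c) < \<epsilon> * real h / 16"
          unfolding accurate_def by auto
        \<comment> \<open>Accuracy would give \<open>\<epsilon> * filled c \<le> 2 * x + 2\<close>.
          The left side is at least \<epsilon> h / 4, the right side less than 3 \<epsilon> h / 16 +
          4, and \<epsilon> h is at least 128.\<close>
        define x where "x = 2 * real (card (hubs c)) + real (uncovered c) + 2 * real f + 1"
        have "ST {..<n} {..<k} (wt k c) \<le> real (filled c) + x"
          using ST_hub_tree_le[of c] yes_support c unfolding x_def by auto
        then have "(2 - \<epsilon>) * ST {..<n} {..<k} (wt k c) \<le> (2 - \<epsilon>) * (real (filled c) + x)"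
          using \<epsilon> by (intro mult_left_mono) auto
        moreover have "\<epsilon> * (real h / 4) \<le> \<epsilon> * real (filled c)"
          using c \<epsilon> unfolding S'_def by (intro mult_left_mono) auto
        moreover have "0 \<le> \<epsilon> * x" unfolding x_def using \<epsilon> by simp
        moreover have "2 * (real (filled c) - 1) \<le> result tr (wt k c)"
          using c unfolding S'_def by simp
        ultimately show False using a \<open>2 * real (card (hubs c)) + real (uncovered c) < \<epsilon> * real h / 16\<close> f h
          unfolding x_def by (simp add: algebra_simps)
      qed
    qed auto
    finally show ?thesis .
  qed
  also have "\<dots> \<le> measure_pmf.prob YES {c. \<not> accurate k n (2 - \<epsilon>) c tr} +
      measure_pmf.prob YES {c. \<epsilon> * real h / 16 \<le> 2 * real (card (hubs c)) + real (uncovered c)}"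
    by (intro measure_Un_le) auto
  finally show ?thesis using lo cost by simp
qed

lemma prob_near_trivial:
  assumes q: "\<And>c. c \<in> set_pmf NO \<Longrightarrow> real (num_queries tr (wt k c)) \<le> q" and "\<kappa> * q \<le> 1 / 2"
  shows "measure_pmf.prob NO {c. \<not> \<kappa> * real (near k n h tr c) \<le> 1 / 2} = 0"
proof -
  have "\<kappa> * real (near k n h tr c) \<le> 1 / 2" if c: "c \<in> set_pmf NO" for c
  proof -
    have "near k n h tr c \<le> num_queries tr (wt k c)"
      using support[OF c] by (intro near_le_num_queries) auto
    then have "real (near k n h tr c) \<le> q" using q[OF c] by linarith
    moreover have "0 \<le> \<kappa>" unfolding \<kappa>_def using \<rho>0 by simp
    ultimately show ?thesis using assms(2) mult_left_mono by fastforce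
  qed
  then show ?thesis by (auto simp: measure_pmf_zero_iff)
qed

end

text \<open>Fubini for a finitely supported \<open>p\<close>: as a function of the coins, the
  failure probability is a finite combination of indicators of events of measure at most
  \<open>d\<close>.\<close>

lemma average_failure_le:
  fixes p :: "'c pmf" and M :: "'o measure"
  assumes "prob_space M" and fin: "finite (set_pmf p)"
    and G: "\<And>c. c \<in> set_pmf p \<Longrightarrow> {\<omega> \<in> space M. G c \<omega>} \<in> sets M"
      "\<And>c. c \<in> set_pmf p \<Longrightarrow> 1 - d \<le> measure M {\<omega> \<in> space M. G c \<omega>}"
  shows "integrable M (\<lambda>\<omega>. measure_pmf.prob p {c. \<not> G c \<omega>})"
    and "(\<integral>\<omega>. measure_pmf.prob p {c. \<not> G c \<omega>} \<partial>M) \<le> d"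
proof -
  interpret prob_space M by fact
  let ?N = "\<lambda>c. space M - {\<omega> \<in> space M. G c \<omega>}"
  have N: "?N c \<in> sets M" if "c \<in> set_pmf p" for c using G(1)[OF that] by auto
  have eq: "measure_pmf.prob p {c. \<not> G c \<omega>} = (\<Sum>c\<in>set_pmf p. pmf p c * indicator (?N c) \<omega>)"
    if "\<omega> \<in> space M" for \<omega>
  proof -
    have "measure_pmf.prob p {c. \<not> G c \<omega>} = measure_pmf.expectation p (\<lambda>c. of_bool (\<not> G c \<omega>))"
      by (rule expectation_of_bool[symmetric])
    also have "\<dots> = (\<Sum>c\<in>set_pmf p. of_bool (\<not> G c \<omega>) * pmf p c)"
      using fin by (intro integral_measure_pmf_real) auto
    finally show ?thesis using that by (auto simp: indicator_def intro!: sum.cong)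
  qed
  have int: "integrable M (\<lambda>\<omega>. \<Sum>c\<in>set_pmf p. pmf p c * indicator (?N c) \<omega>)"
    using N by (intro Bochner_Integration.integrable_sum integrable_mult_right)
      (auto intro!: integrable_real_indicator simp: emeasure_eq_measure)
  then show "integrable M (\<lambda>\<omega>. measure_pmf.prob p {c. \<not> G c \<omega>})"
    by (subst Bochner_Integration.integrable_cong[OF refl eq]) auto
  have "(\<integral>\<omega>. measure_pmf.prob p {c. \<not> G c \<omega>} \<partial>M) =
      (\<integral>\<omega>. (\<Sum>c\<in>set_pmf p. pmf p c * indicator (?N c) \<omega>) \<partial>M)"
    by (intro Bochner_Integration.integral_cong refl eq)
  also have "\<dots> = (\<Sum>c\<in>set_pmf p. \<integral>\<omega>. pmf p c * indicator (?N c) \<omega> \<partial>M)"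
    using N by (intro Bochner_Integration.integral_sum integrable_mult_right)
      (auto intro!: integrable_real_indicator simp: emeasure_eq_measure)
  also have "\<dots> = (\<Sum>c\<in>set_pmf p. pmf p c * measure M (?N c))"
    by (intro sum.cong refl) (use N in \<open>simp add: Int_absorb2 sets.sets_into_space\<close>)
  also have "\<dots> \<le> (\<Sum>c\<in>set_pmf p. pmf p c * d)"
  proof (intro sum_mono mult_left_mono)
    fix c assume c: "c \<in> set_pmf p"
    show "measure M (?N c) \<le> d" using prob_compl[OF G(1)[OF c]] G(2)[OF c] by simp
  qed simp
  also have "\<dots> = d"
    using fin by (simp add: sum_distrib_right[symmetric] sum_pmf_eq_1)
  finally show "(\<integral>\<omega>. measure_pmf.prob p {c. \<not> G c \<omega>} \<partial>M) \<le> d" .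
qed

text \<open>Yao-type averaging: integrating out the coins turns a failure bound for almost all coins
  into one on the error probability \<open>d\<close>; 3 is the total weight 1 + 2.\<close>

lemma average_failure_ge:
  fixes p p' :: "'c pmf" and M :: "'o measure"
  assumes M: "prob_space M" and fin: "finite (set_pmf p)" "finite (set_pmf p')"
    and G: "\<And>c. c \<in> set_pmf p \<union> set_pmf p' \<Longrightarrow> {\<omega> \<in> space M. G c \<omega>} \<in> sets M"
      "\<And>c. c \<in> set_pmf p \<union> set_pmf p' \<Longrightarrow> 1 - d \<le> measure M {\<omega> \<in> space M. G c \<omega>}"
    and ge: "AE \<omega> in M. r \<le> measure_pmf.prob p {c. \<not> G c \<omega>} + 2 * measure_pmf.prob p' {c. \<not> G c \<omega>}"
  shows "r \<le> 3 * d"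
proof -
  interpret prob_space M by fact
  have p: "integrable M (\<lambda>\<omega>. measure_pmf.prob p {c. \<not> G c \<omega>})"
    "(\<integral>\<omega>. measure_pmf.prob p {c. \<not> G c \<omega>} \<partial>M) \<le> d"
    using G by (auto intro!: average_failure_le[OF M fin(1)])
  have p': "integrable M (\<lambda>\<omega>. measure_pmf.prob p' {c. \<not> G c \<omega>})"
    "(\<integral>\<omega>. measure_pmf.prob p' {c. \<not> G c \<omega>} \<partial>M) \<le> d"
    using G by (auto intro!: average_failure_le[OF M fin(2)])
  have "r = (\<integral>\<omega>. r \<partial>M)" using prob_space by simp
  also have "\<dots> \<le> (\<integral>\<omega>. measure_pmf.prob p {c. \<not> G c \<omega>} + 2 * measure_pmf.prob p' {c. \<not> G c \<omega>} \<partial>M)"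
    using ge p(1) p'(1) by (intro integral_mono_AE) auto
  also have "\<dots> = (\<integral>\<omega>. measure_pmf.prob p {c. \<not> G c \<omega>} \<partial>M) + 2 * (\<integral>\<omega>. measure_pmf.prob p' {c. \<not> G c \<omega>} \<partial>M)"
    using p(1) p'(1) by simp
  finally show ?thesis using p(2) p'(2) by simp
qed

text \<open>If fewer than \<open>B\<close> queries always sufficed, the weighted failure would be at
  least 1/5 for almost all coins, while the error bound permits only 3/100.\<close>

lemma (in hard_instance) worst_case_queries:
  fixes \<epsilon> B :: real
  assumes alg: "randomized_algorithm M A" "estimates_ST M A (2 - \<epsilon>) \<delta>"
    and \<epsilon>: "0 < \<epsilon>" "\<epsilon> < 1" and \<delta>: "\<delta> n \<le> 1 / 100"
    and near: "\<And>tr. (\<And>c. c \<in> set_pmf NO \<Longrightarrow> real (num_queries tr (wt k c)) \<le> B) \<Longrightarrow>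
      measure_pmf.prob NO {c. \<not> \<kappa> * real (near k n h tr c) \<le> 1 / 2} \<le> 1 / 24"
    and cost: "measure_pmf.prob YES {c. \<epsilon> * real h / 16 \<le> 2 * real (card (hubs c)) + real (uncovered c)} \<le> 1 / 24"
    and f: "real f \<le> \<epsilon> * real h / 64" and h: "128 \<le> \<epsilon> * real h"
  shows "worst_case_queries_at_least M A n k B"
proof (rule ccontr)
  assume "\<not> worst_case_queries_at_least M A n k B"
  then have few: "AE \<omega> in M. real (num_queries (A {..<n} {..<k} \<omega>) w) < B"
    if "steiner_instance {..<n} {..<k} w" for w
    using that unfolding worst_case_queries_at_least_def by (metis card_lessThan)
  have M: "prob_space M" and within: "\<And>\<omega>. \<omega> \<in> space M \<Longrightarrow> queries_within {..<n} (A {..<n} {..<k} \<omega>)"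
    using alg(1) unfolding randomized_algorithm_def by auto
  let ?G = "\<lambda>c \<omega>. accurate k n (2 - \<epsilon>) c (A {..<n} {..<k} \<omega>)"
  have G2: "1 - 1 / 100 \<le> measure M {\<omega> \<in> space M. ?G c \<omega>}" if c: "c \<in> set_pmf NO \<union> set_pmf YES" for c
  proof -
    have "steiner_instance {..<n} {..<k} (wt k c)" using c NO_instance YES_instance by blast
    then have "1 - \<delta> (card {..<n}) \<le> measure M {\<omega> \<in> space M. ?G c \<omega>}"
      using alg(2) unfolding estimates_ST_def accurate_def by blast
    then show ?thesis using \<delta> by simp
  qed
  \<comment> \<open>A set that is not an event has measure 0, so the success bound forces
    measurability.\<close>
  have G1: "{\<omega> \<in> space M. ?G c \<omega>} \<in> sets M" if c: "c \<in> set_pmf NO \<union> set_pmf YES" for c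
  proof (rule ccontr)
    assume "{\<omega> \<in> space M. ?G c \<omega>} \<notin> sets M"
    then have "measure M {\<omega> \<in> space M. ?G c \<omega>} = 0" by (rule measure_notin_sets)
    then show False using G2[OF c] by simp
  qed
  \<comment> \<open>The support is finite, so the exceptional null sets can be united.\<close>
  have "AE \<omega> in M. \<forall>c\<in>set_pmf NO. real (num_queries (A {..<n} {..<k} \<omega>) (wt k c)) < B"
    using few NO_instance by (intro AE_finite_allI finP) auto
  then have "AE \<omega> in M. 1 / 5 \<le> measure_pmf.prob NO {c. \<not> ?G c \<omega>} + 2 * measure_pmf.prob YES {c. \<not> ?G c \<omega>}"
  proof (rule AE_mp, intro AE_I2 impI)
    fix \<omega> assume \<omega>: "\<omega> \<in> space M"
      and "\<forall>c\<in>set_pmf NO. real (num_queries (A {..<n} {..<k} \<omega>) (wt k c)) < B"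
    then have "measure_pmf.prob NO {c. \<not> \<kappa> * real (near k n h (A {..<n} {..<k} \<omega>) c) \<le> 1 / 2} \<le> 1 / 24"
      by (intro near) force
    then show "1 / 5 \<le> measure_pmf.prob NO {c. \<not> ?G c \<omega>} + 2 * measure_pmf.prob YES {c. \<not> ?G c \<omega>}"
      by (rule inaccurate_on_average[OF \<epsilon> within[OF \<omega>] _ cost f h])
  qed
  from average_failure_ge[OF M finP finite_YES G1 G2 this] show False by simp
qed

section \<open>The lower bound\<close>

lemma eventually_powr_le:
  fixes C e r :: real
  assumes "0 < e" "0 < r"
  shows "\<forall>\<^sub>F k in sequentially. C * real k powr (- e) \<le> r"
proof -
  have "(\<lambda>k. real k powr (- e)) \<longlonglongrightarrow> 0"
    using assms(1) by (intro tendsto_neg_powr filterlim_real_sequentially) auto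
  then have "(\<lambda>k. C * real k powr (- e)) \<longlonglongrightarrow> 0"
    by (rule tendsto_mult_right_zero)
  from order_tendstoD(2)[OF this assms(2)] show ?thesis
    by (rule eventually_mono) simp
qed

context hard_instance
begin

text \<open>Serves the case n < k^(6/5); each of the three terms of \<open>prob_near\<close> is made
  at most 1/72.\<close>

lemma prob_near_small:
  fixes \<phi> z B :: real
  assumes q: "\<And>c. c \<in> set_pmf NO \<Longrightarrow> real (num_queries tr (wt k c)) \<le> B"
    and B: "B \<le> 2 * real k powr (6 / 5)"
    and \<phi>: "0 < \<phi>" "\<phi> * real h \<le> real f"
    and h: "real k powr (2 / 3) / 2 \<le> real h" "real h \<le> real k powr (2 / 3)"
    and z: "0 < z" "\<kappa> * (z * real k) \<le> 1 / 2"
    and big: "2 / z * real k powr (- (1 / 20)) \<le> 1"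
      "8 * (1 + 4 / \<phi>) * real k powr (- (1 / 10)) \<le> 1 / 72"
      "80 / \<phi> * real k powr (- (7 / 60)) \<le> 1 / 72"
      "16 / z * real k powr (- (2 / 15)) \<le> 1 / 72"
  shows "measure_pmf.prob NO {c. \<not> \<kappa> * real (near k n h tr c) \<le> 1 / 2} \<le> 1 / 24"
proof -
  define x where "x = real k"
  have x: "0 < x" and xp: "0 < x powr e" for e using pos unfolding x_def by auto
  \<comment> \<open>The three expectations are at most of order k^(1/5), k^(8/15) and k^(13/15). The
    thresholds exceed them by powers of \<open>k\<close>, yet
    \<open>?a * ?b + ?d \<le> z * x\<close> holds for large \<open>k\<close> because 3/10 + 13/20 <
    1.\<close>
  let ?a = "x powr (3 / 10)" and ?b = "x powr (13 / 20)" and ?d = "z * x / 2"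
  have "?a * ?b = x * x powr (- (1 / 20))"
    using x by (simp add: powr_add[symmetric] powr_mult_base)
  also have "\<dots> = ?d * (2 / z * x powr (- (1 / 20)))" using z(1) by simp
  also have "\<dots> \<le> ?d * 1" using big(1) z(1) x unfolding x_def by (intro mult_left_mono) auto
  finally have ab: "?a * ?b + ?d \<le> z * x" by simp
  have \<kappa>0: "0 \<le> \<kappa>" unfolding \<kappa>_def using \<rho>0 by simp
  have "measure_pmf.prob NO {c. \<not> \<kappa> * real (near k n h tr c) \<le> 1 / 2} \<le>
      measure_pmf.prob NO {c. ?a * ?b + ?d \<le> real (near k n h tr c)}"
  proof (intro measure_pmf.finite_measure_mono subsetI, simp_all)
    fix c assume n: "\<not> \<kappa> * real (near k n h tr c) * 2 \<le> 1"
    show "?a * ?b + ?d \<le> real (near k n h tr c)"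
    proof (rule ccontr)
      assume "\<not> ?a * ?b + ?d \<le> real (near k n h tr c)"
      then have "\<kappa> * real (near k n h tr c) \<le> \<kappa> * (z * x)"
        using ab \<kappa>0 by (intro mult_left_mono) auto
      then show False using n z(2) unfolding x_def by simp
    qed
  qed
  also have "\<dots> \<le> (1 / real k + real h / real k * (4 / real f)) * (4 * B) / ?a
      + 5 / real f * (4 * B) / ?b + real h / real k * (4 * B) / ?d"
    by (rule prob_near[OF q]) (use x z(1) in auto)
  also have "(1 / real k + real h / real k * (4 / real f)) * (4 * B) / ?a \<le> 1 / 72"
  proof -
    have "real h / real f \<le> 1 / \<phi>" using \<phi> pos by (simp add: field_simps)
    then have "4 / x * (real h / real f) \<le> 4 / x * (1 / \<phi>)" using x by (intro mult_left_mono) auto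
    then have "1 / real k + real h / real k * (4 / real f) \<le> (1 + 4 / \<phi>) / x"
      unfolding x_def by (simp add: field_simps add_divide_distrib)
    moreover have "0 \<le> (1 + 4 / \<phi>) / x" using x \<phi>(1) by simp
    moreover have B8: "4 * B \<le> 8 * x powr (6 / 5)" using B unfolding x_def by simp
    ultimately have "(1 / real k + real h / real k * (4 / real f)) * (4 * B) \<le>
        (1 + 4 / \<phi>) / x * (8 * x powr (6 / 5))"
      using pos by (meson mult_left_mono mult_right_mono order_trans powr_ge_zero
          add_nonneg_nonneg divide_nonneg_nonneg mult_nonneg_nonneg of_nat_0_le_iff zero_le_numeral zero_le_one)
    then have "(1 / real k + real h / real k * (4 / real f)) * (4 * B) / ?a \<le>
        (1 + 4 / \<phi>) / x * (8 * x powr (6 / 5)) / ?a"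
      by (intro divide_right_mono) auto
    also have "\<dots> = 8 * (1 + 4 / \<phi>) * (x powr (6 / 5) / (x powr 1 * ?a))"
      using x by simp
    also have "x powr (6 / 5) / (x powr 1 * ?a) = x powr (- (1 / 10))"
      unfolding powr_add[symmetric] powr_diff[symmetric] by simp
    finally show ?thesis using big(2) unfolding x_def by simp
  qed
  also have "5 / real f * (4 * B) / ?b \<le> 1 / 72"
  proof -
    have "\<phi> * (x powr (2 / 3) / 2) \<le> \<phi> * real h" using \<phi>(1) h(1) unfolding x_def by (intro mult_left_mono) auto
    then have fl: "\<phi> * x powr (2 / 3) / 2 \<le> real f" using \<phi>(2) by simp
    have "5 / real f * (4 * B) \<le> 5 / real f * (8 * x powr (6 / 5))"
      using B unfolding x_def by (intro mult_left_mono) auto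
    also have "\<dots> \<le> 5 / (\<phi> * x powr (2 / 3) / 2) * (8 * x powr (6 / 5))"
      using fl \<phi>(1) xp[of "2 / 3"] x pos by (intro mult_right_mono divide_left_mono mult_pos_pos) auto
    finally have "5 / real f * (4 * B) / ?b \<le> 5 / (\<phi> * x powr (2 / 3) / 2) * (8 * x powr (6 / 5)) / ?b"
      by (intro divide_right_mono) auto
    also have "\<dots> = 80 / \<phi> * (x powr (6 / 5) / (x powr (2 / 3) * ?b))" by simp
    also have "x powr (6 / 5) / (x powr (2 / 3) * ?b) = x powr (- (7 / 60))"
      unfolding powr_add[symmetric] powr_diff[symmetric] by simp
    finally show ?thesis using big(3) unfolding x_def by simp
  qed
  also have "real h / real k * (4 * B) / ?d \<le> 1 / 72"
  proof -
    have "real h / real k * (4 * B) \<le> real h / real k * (8 * x powr (6 / 5))"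
      using B unfolding x_def by (intro mult_left_mono) auto
    also have "\<dots> \<le> x powr (2 / 3) / x * (8 * x powr (6 / 5))"
      using h(2) unfolding x_def by (intro mult_right_mono divide_right_mono) auto
    finally have "real h / real k * (4 * B) / ?d \<le> x powr (2 / 3) / x * (8 * x powr (6 / 5)) / ?d"
      using x z(1) by (intro divide_right_mono) auto
    also have "\<dots> = 16 / z * ((x powr (2 / 3) * x powr (6 / 5)) / (x powr 1 * x powr 1))"
      using x by simp
    also have "(x powr (2 / 3) * x powr (6 / 5)) / (x powr 1 * x powr 1) = x powr (- (2 / 15))"
      unfolding powr_add[symmetric] powr_diff[symmetric] by simp
    finally show ?thesis using big(4) unfolding x_def by simp
  qed
  finally show ?thesis by simp
qed

end

theorem theorem1p4:
  fixes \<epsilon> \<gamma> :: real and \<delta> :: "nat \<Rightarrow> real"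
  assumes "0 < \<epsilon>" and "\<epsilon> < 1 / 3"
    and "\<delta> \<longlonglongrightarrow> 0"
    and "\<gamma> < 1"
  shows "\<exists>c>0. \<exists>d k\<^sub>0 :: nat. \<forall>M A.
           randomized_algorithm M A \<and> estimates_ST M A (2 - \<epsilon>) \<delta> \<longrightarrow>
           (\<forall>n k :: nat. k\<^sub>0 \<le> k \<and> real k \<le> \<gamma> * real n \<longrightarrow>
              worst_case_queries_at_least M A n k
                (c * (real n + real k powr (6 / 5)) / ln (real n) ^ d))"
proof -
  \<comment> \<open>The expected number of hubs will be \<theta> h, and \<open>s\<close> is such
    that a label stays uncovered with probability at most \<epsilon> / 768. The Markov bound for the
    cost then equals 1/24.\<close>
  define \<theta> where "\<theta> = \<epsilon> / 1536"
  define s where "s = max 1 (ln (768 / \<epsilon>) / \<theta>)"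
  \<comment> \<open>\<open>\<kappa>\<close> will be \<open>1 / (2 * y * N)\<close> with
    \<open>N = n - k\<close>, so \<open>near\<close> may be as large as \<open>y * N\<close>;
    \<open>z\<close> expresses this through \<open>n\<close> or \<open>k\<close>.\<close>
  define y where "y = 1 / (2 * \<theta> * s\<^sup>2)"
  define z where "z = y * (1 - \<gamma>)"
  define \<phi> where "\<phi> = \<epsilon> / 128"
  \<comment> \<open>\<open>z / 2\<close> serves the case of large \<open>n\<close>, and 1 the other
    case.\<close>
  define c where "c = min 1 (z / 2)"
  have \<theta>: "0 < \<theta>" unfolding \<theta>_def using assms(1) by simp
  have s: "1 \<le> s" unfolding s_def by simp
  have y: "0 < y" unfolding y_def using \<theta> s by simp
  have z: "0 < z" unfolding z_def using y assms(4) by simp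
  have \<phi>: "0 < \<phi>" unfolding \<phi>_def using assms(1) by simp
  have c: "0 < c" "c \<le> 1" "2 * c \<le> z" unfolding c_def using z by auto
  have exps: "exp (- (\<theta> * s)) \<le> \<epsilon> / 768"
  proof -
    have "ln (768 / \<epsilon>) \<le> \<theta> * s"
      using \<theta> unfolding s_def by (simp add: max_def field_simps)
    then have "exp (- (\<theta> * s)) \<le> exp (- ln (768 / \<epsilon>))" by simp
    also have "\<dots> = \<epsilon> / 768" using assms(1) by (simp add: exp_minus)
    finally show ?thesis .
  qed
  have "\<forall>\<^sub>F n in sequentially. \<delta> n < 1 / 100"
    using order_tendstoD(2)[OF assms(3), of "1 / 100"] by simp
  then obtain n\<^sub>0 where n0: "\<And>n. n\<^sub>0 \<le> n \<Longrightarrow> \<delta> n \<le> 1 / 100"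
    unfolding eventually_sequentially by (meson less_imp_le)
  \<comment> \<open>Once \<open>H\<close> is at most \<open>k powr (2 / 3)\<close>, the rounded
    value \<open>h\<close> is at least \<open>s + 128 / \<epsilon>\<close>.\<close>
  define H where "H = 2 * (s + 128 / \<epsilon>)"
  have "\<forall>\<^sub>F k in sequentially. 1 \<le> k \<and> n\<^sub>0 \<le> k \<and>
      H * real k powr (- (2 / 3)) \<le> 1 \<and> \<theta> * s / (1 - \<gamma>) * real k powr (- (1 / 3)) \<le> 1 \<and>
      2 / z * real k powr (- (1 / 20)) \<le> 1 \<and>
      8 * (1 + 4 / \<phi>) * real k powr (- (1 / 10)) \<le> 1 / 72 \<and>
      80 / \<phi> * real k powr (- (7 / 60)) \<le> 1 / 72 \<and>
      16 / z * real k powr (- (2 / 15)) \<le> 1 / 72"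
    by (intro eventually_conj eventually_powr_le eventually_ge_at_top) auto
  then obtain k\<^sub>0 where k0: "\<And>k. k\<^sub>0 \<le> k \<Longrightarrow> 1 \<le> k \<and> n\<^sub>0 \<le> k \<and>
      H * real k powr (- (2 / 3)) \<le> 1 \<and> \<theta> * s / (1 - \<gamma>) * real k powr (- (1 / 3)) \<le> 1 \<and>
      2 / z * real k powr (- (1 / 20)) \<le> 1 \<and>
      8 * (1 + 4 / \<phi>) * real k powr (- (1 / 10)) \<le> 1 / 72 \<and>
      80 / \<phi> * real k powr (- (7 / 60)) \<le> 1 / 72 \<and>
      16 / z * real k powr (- (2 / 15)) \<le> 1 / 72"
    unfolding eventually_sequentially by blast
  \<comment> \<open>The bound comes without a logarithmic factor; the exponent \<open>d\<close> is
    taken to be 0 at the end.\<close>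
  have "worst_case_queries_at_least M A n k (c * (real n + real k powr (6 / 5)))"
    if alg: "randomized_algorithm M A" "estimates_ST M A (2 - \<epsilon>) \<delta>"
      and k: "k\<^sub>0 \<le> k" "real k \<le> \<gamma> * real n" for M A and n k :: nat
  proof -
    note big = k0[OF k(1)]
    have kpos: "0 < real k" using big by simp
    have n: "0 < n" using k(2) kpos by (cases n) auto
    have "\<gamma> * real n < real n" using assms(4) n by simp
    then have kn: "k < n" using k(2) by linarith
    define N where "N = real (n - k)"
    have N: "(1 - \<gamma>) * real n \<le> N" unfolding N_def using k(2) kn by (simp add: of_nat_diff algebra_simps)
    have nk: "(1 - \<gamma>) * real k \<le> (1 - \<gamma>) * real n" using kn assms(4) by (intro mult_left_mono) auto
    have Npos: "0 < N" unfolding N_def using kn by simp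
    define r where "r = real k powr (2 / 3)"
    have r: "0 < r" unfolding r_def using kpos by simp
    define h where "h = nat \<lfloor>r\<rfloor>"
    define f where "f = nat \<lfloor>\<epsilon> * real h / 64\<rfloor>"
    define \<rho> where "\<rho> = \<theta> * real h / N"
    have r_inv: "real k powr (- (2 / 3)) = 1 / r" unfolding r_def by (simp add: powr_minus_divide)
    have "H * real k powr (- (2 / 3)) \<le> 1" using big by blast
    then have Hr: "H \<le> r" unfolding r_inv using r by (simp add: field_simps)
    have H2: "2 \<le> H" unfolding H_def using s assms(1) by (simp add: add_increasing2)
    have hr: "real h \<le> r" "r - 1 \<le> real h"
      unfolding h_def using r by linarith+
    then have hr2: "r / 2 \<le> real h" using Hr H2 by linarith
    then have "H / 2 \<le> real h" using Hr by linarith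
    then have hH: "s + 128 / \<epsilon> \<le> real h" unfolding H_def by simp
    have "\<epsilon> * (128 / \<epsilon>) \<le> \<epsilon> * real h"
      using hH s assms(1) by (intro mult_left_mono) auto
    then have \<epsilon>h: "128 \<le> \<epsilon> * real h" using assms(1) by simp
    have f: "real f \<le> \<epsilon> * real h / 64" "\<epsilon> * real h / 64 - 1 \<le> real f"
      unfolding f_def using \<epsilon>h by linarith+
    have \<phi>f: "\<phi> * real h \<le> real f" using f(2) \<epsilon>h unfolding \<phi>_def by simp
    have f2: "2 \<le> f" unfolding f_def using \<epsilon>h by (simp add: le_nat_iff le_floor_iff)
    have "\<epsilon> * real h \<le> 1 * real h" using assms(2) by (intro mult_right_mono) auto
    then have fh: "f \<le> h" using f(1) by linarith
    have rk: "r \<le> real k" unfolding r_def using powr_mono[of "2 / 3" 1 "real k"] big by simp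
    have hk: "h \<le> k" using hr(1) rk by linarith
    have hs: "s \<le> real h" using hH assms(1) by (smt (verit) divide_pos_pos)
    have \<rho>0: "0 \<le> \<rho>" unfolding \<rho>_def using \<theta> Npos by simp
    have "\<theta> * s * r \<le> (1 - \<gamma>) * real k"
    proof -
      have rk3: "r * real k powr (1 / 3) = real k"
        unfolding r_def powr_add[symmetric] using kpos by simp
      have "\<theta> * s / (1 - \<gamma>) / real k powr (1 / 3) \<le> 1"
        using big by (simp add: powr_minus_divide)
      then have "\<theta> * s \<le> (1 - \<gamma>) * real k powr (1 / 3)"
        using assms(4) kpos by (simp add: field_simps)
      then have "\<theta> * s * r \<le> (1 - \<gamma>) * real k powr (1 / 3) * r"
        using r by (intro mult_right_mono) auto
      also have "\<dots> = (1 - \<gamma>) * (r * real k powr (1 / 3))" by (simp only: mult_ac)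
      finally show ?thesis unfolding rk3 .
    qed
    moreover have "\<theta> * s * real h \<le> \<theta> * s * r" using hr(1) \<theta> s by (intro mult_left_mono) auto
    ultimately have \<rho>s: "\<rho> * s \<le> 1"
      unfolding \<rho>_def using Npos N nk by (simp add: field_simps)
    interpret hard_instance k n h f \<rho> s
      using f2 fh hk kn s hs \<rho>0 \<rho>s by unfold_locales
    have "\<kappa> = \<rho> * s\<^sup>2 / real h" by (rule \<kappa>_def)
    \<comment> \<open>The factor \<open>h\<close> cancels, so \<open>\<kappa>\<close> is of order
      1/N.\<close>
    also have "\<dots> = 1 / (2 * y * N)"
      unfolding \<rho>_def y_def using pos \<theta> s Npos by (simp add: field_simps)
    finally have \<kappa>: "\<kappa> = 1 / (2 * y * N)" .
    have \<kappa>N: "\<kappa> * q \<le> 1 / 2" if "q \<le> y * N" for q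
    proof -
      have "\<kappa> * q \<le> \<kappa> * (y * N)" unfolding \<kappa> using that y Npos by (intro mult_left_mono) auto
      also have "\<dots> = 1 / 2" unfolding \<kappa> using y Npos by simp
      finally show ?thesis .
    qed
    have zn: "z * real n \<le> y * N" "z * real k \<le> y * N"
      using mult_left_mono[OF N, of y] mult_left_mono[OF order_trans[OF nk N], of y] y
      unfolding z_def by (auto simp: mult.assoc)
    show ?thesis
    proof (rule worst_case_queries[OF alg assms(1) _ _ _ _ f(1) \<epsilon>h])
      show "\<epsilon> < 1" using assms(2) by simp
      show "\<delta> n \<le> 1 / 100" using n0[of n] big kn by linarith
      show "measure_pmf.prob NO {x. \<not> \<kappa> * real (near k n h tr x) \<le> 1 / 2} \<le> 1 / 24"
        if q: "\<And>x. x \<in> set_pmf NO \<Longrightarrow> real (num_queries tr (wt k x)) \<le> c * (real n + real k powr (6 / 5))"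
        for tr
      \<comment> \<open>For large \<open>n\<close> all queries together are few enough; otherwise
        the exposure bounds take over.\<close>
      proof (cases "real k powr (6 / 5) \<le> real n")
        case True
        then have "c * (real n + real k powr (6 / 5)) \<le> c * (2 * real n)"
          using c by (intro mult_left_mono) auto
        also have "\<dots> \<le> z * real n" using c(3) mult_right_mono[of "2 * c" z "real n"] by simp
        also have "\<dots> \<le> y * N" by (rule zn)
        finally have "\<kappa> * (c * (real n + real k powr (6 / 5))) \<le> 1 / 2" by (rule \<kappa>N)
        from prob_near_trivial[OF q this] show ?thesis by simp
      next
        case False
        have "c * (real n + real k powr (6 / 5)) \<le> 1 * (real n + real k powr (6 / 5))"
          using c by (intro mult_right_mono) auto
        also have "\<dots> \<le> 2 * real k powr (6 / 5)" using False by simp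
        finally have B: "c * (real n + real k powr (6 / 5)) \<le> 2 * real k powr (6 / 5)" .
        note bound = prob_near_small[OF q B \<phi> \<phi>f hr2[unfolded r_def] hr(1)[unfolded r_def] z
          \<kappa>N[OF zn(2)]]
        show ?thesis by (rule bound) (use big in blast)+
      qed
      show "measure_pmf.prob YES {x. \<epsilon> * real h / 16 \<le> 2 * real (card (hubs x)) + real (uncovered x)} \<le> 1 / 24"
      proof -
        have "\<rho> * N = \<theta> * real h" unfolding \<rho>_def using Npos by simp
        moreover have "\<rho> * s / real h * N = \<theta> * s" unfolding \<rho>_def using Npos pos by simp
        ultimately have "measure_pmf.prob YES {x. \<epsilon> * real h / 16 \<le> 2 * real (card (hubs x)) + real (uncovered x)} \<le>
            (2 * (\<theta> * real h) + real h * exp (- (\<theta> * s))) / (\<epsilon> * real h / 16)"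
          using prob_YES_cost[of "\<epsilon> * real h / 16"] assms(1) pos unfolding N_def
          by (simp add: mult.assoc)
        also have "\<dots> = (2 * \<theta> + exp (- (\<theta> * s))) * 16 / \<epsilon>"
          using pos assms(1) by (simp add: field_simps)
        also have "\<dots> \<le> (2 * \<theta> + \<epsilon> / 768) * 16 / \<epsilon>"
          using exps assms(1) by (intro divide_right_mono mult_right_mono add_left_mono) auto
        also have "\<dots> = 1 / 24" unfolding \<theta>_def using assms(1) by (simp add: field_simps)
        finally show ?thesis .
      qed
    qed
  qed
  then show ?thesis using c(1) by (intro exI[of _ c] conjI exI[of _ 0] exI[of _ k\<^sub>0]) auto
qed

end
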